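(* Let $N\in\mathbb{N}$ and consider for each $1\le i\le N$ an adjoint operator $T_i:X_i\to X_i$ on a separable dual Banach space $X_i$. Then, for the direct sum operator $T=T_1\oplus\cdots\oplus T_N:X\to X$ on the direct sum space $X=X_1\oplus\cdots\oplus X_N$, we have $$\overline{\operatorname{FRec}(T)}=\prod_{i=1}^N\overline{\operatorname{RRec}(T_i)}.$$ In particular, the following statements are equivalent: (i) $T$ is frequently recurrent; (ii) $T$ is $\mathcal{U}$-frequently recurrent; (iii) $T$ is reiteratively recurrent; (iv) $T_i$ is reiteratively recurrent for every $1\le i\le N$. Moreover, the result holds whenever some of the $T_i$ are (instead) bounded linear operators defined on some reflexive Banach spaces $X_i$.
   Context: $\mathbb{N}_0=\{0,1,2,\dots\}$. Banach spaces may be real or complex. "Adjoint operator on a separable dual Banach space" means: $X_i=Y_i^*$ is the dual of a Banach space $Y_i$, $X_i$ is norm-separable, and $T_i=S_i^*$ for some bounded linear operator $S_i:Y_i\to Y_i$. The direct sum $X_1\oplus\cdots\oplus X_N$ carries any norm defining the product topology, and $T(x_1,\dots,x_N)=(T_1x_1,\dots,T_Nx_N)$. Closures are in the norm topologies. $N(x,A)=\{n\in\mathbb{N}_0: S^nx\in A\}$ for an operator $S$. For $A\subset\mathbb{N}_0$: $\underline{\operatorname{dens}}(A)=\liminf_{N\to\infty}\frac{\operatorname{card}(A\cap[0,N])}{N+1}$, $\overline{\operatorname{dens}}(A)=\limsup_{N\to\infty}\frac{\operatorname{card}(A\cap[0,N])}{N+1}$, $\overline{\operatorname{Bd}}(A)=\limsup_{N\to\infty}\left(\max_{m\ge0}\frac{\operatorname{card}(A\cap[m,m+N])}{N+1}\right)$.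 $\operatorname{FRec}(S)$ (resp. $\operatorname{UFRec}(S)$, $\operatorname{RRec}(S)$) is the set of points $x$ such that $\underline{\operatorname{dens}}(N(x,U))>0$ (resp. $\overline{\operatorname{dens}}(N(x,U))>0$, $\overline{\operatorname{Bd}}(N(x,U))>0$) for every norm neighbourhood $U$ of $x$. $S$ is frequently (resp. $\mathcal{U}$-frequently, reiteratively) recurrent if the corresponding set is dense. *)

theory Defs
  imports "HOL-Analysis.Analysis" "HOL-Algebra.Module"
begin

section \<open>Banach spaces with explicit carriers\<close>

text \<open>
  The summands are different Banach spaces, finite in number but not fixed in number, so they
  cannot be type class instances; they are structures extending the modules of HOL-Algebra by a
  norm. (As for every \<open>module\<close> record, the fields \<open>mult\<close> and \<open>one\<close> are irrelevant.)

  Scalars are a type of class \<open>{real_normed_field, euclidean_space}\<close>. Both \<open>real\<close> and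
  \<open>complex\<close> are instances, and by the Frobenius (or Gelfand-Mazur) theorem every instance is
  isometrically isomorphic, as a normed field, to one of them. A statement about all such
  types is therefore a statement about real and complex Banach spaces.
\<close>

record ('k, 'x) normed_module = "('k, 'x) module" +
  vnorm :: "'x \<Rightarrow> real"

definition scalar_space :: "('k::{real_normed_field,euclidean_space}, 'k) normed_module" where
  "scalar_space = \<lparr>carrier = UNIV, mult = (*), one = 1, zero = 0, add = (+),
                   smult = (*), vnorm = norm\<rparr>"

locale normed_vector_space = Module.module scalar_space X
  for X :: "('k::{real_normed_field,euclidean_space}, 'x) normed_module" (structure) +
  assumes vnorm_nonneg: "x \<in> carrier X \<Longrightarrow> 0 \<le> vnorm X x"
    and vnorm_eq_0_iff: "x \<in> carrier X \<Longrightarrow> vnorm X x = 0 \<longleftrightarrow> x = \<zero>"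
    and vnorm_smult: "x \<in> carrier X \<Longrightarrow> vnorm X (c \<odot> x) = norm c * vnorm X x"
    and vnorm_triangle:
      "x \<in> carrier X \<Longrightarrow> y \<in> carrier X \<Longrightarrow> vnorm X (x \<oplus> y) \<le> vnorm X x + vnorm X y"

text \<open>
  The value off the carrier is fixed only because \<open>Metric_space\<close> asks for nonnegativity and
  symmetry on the whole type.
\<close>

definition vdist :: "('k, 'x) normed_module \<Rightarrow> 'x \<Rightarrow> 'x \<Rightarrow> real" where
  "vdist X x y = (if x \<in> carrier X \<and> y \<in> carrier X then vnorm X (x \<ominus>\<^bsub>X\<^esub> y) else 0)"

definition norm_topology :: "('k, 'x) normed_module \<Rightarrow> 'x topology" where
  "norm_topology X = Metric_space.mtopology (carrier X) (vdist X)"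

locale banach_space = normed_vector_space +
  assumes complete: "Metric_space.mcomplete (carrier X) (vdist X)"

definition bounded_linear_map ::
  "('k::{real_normed_field,euclidean_space}, 'x) normed_module \<Rightarrow> ('k, 'y) normed_module
     \<Rightarrow> ('x \<Rightarrow> 'y) \<Rightarrow> bool" where
  "bounded_linear_map X Y T \<longleftrightarrow>
     T \<in> carrier X \<rightarrow> carrier Y \<and>
     (\<forall>x\<in>carrier X. \<forall>y\<in>carrier X. T (x \<oplus>\<^bsub>X\<^esub> y) = T x \<oplus>\<^bsub>Y\<^esub> T y) \<and>
     (\<forall>c. \<forall>x\<in>carrier X. T (c \<odot>\<^bsub>X\<^esub> x) = c \<odot>\<^bsub>Y\<^esub> T x) \<and>
     (\<exists>C. \<forall>x\<in>carrier X. vnorm Y (T x) \<le> C * vnorm X x)"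

definition isometric_isomorphism ::
  "('k::{real_normed_field,euclidean_space}, 'x) normed_module \<Rightarrow> ('k, 'y) normed_module
     \<Rightarrow> ('x \<Rightarrow> 'y) \<Rightarrow> bool" where
  "isometric_isomorphism X Y J \<longleftrightarrow>
     bounded_linear_map X Y J \<and> bij_betw J (carrier X) (carrier Y) \<and>
     (\<forall>x\<in>carrier X. vnorm Y (J x) = vnorm X x)"


section \<open>Duals, adjoints, reflexivity\<close>

text \<open>Functionals are made extensional, so that equality is equality on the carrier.\<close>

definition dual_space ::
  "('k::{real_normed_field,euclidean_space}, 'y) normed_module \<Rightarrow> ('k, 'y \<Rightarrow> 'k) normed_module"
  where
  "dual_space Y =
     \<lparr>carrier = {f \<in> extensional (carrier Y). bounded_linear_map Y scalar_space f},
      mult = undefined, one = undefined,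
      zero = (\<lambda>y\<in>carrier Y. 0),
      add = (\<lambda>f g. \<lambda>y\<in>carrier Y. f y + g y),
      smult = (\<lambda>c f. \<lambda>y\<in>carrier Y. c * f y),
      vnorm = (\<lambda>f. SUP y\<in>{y \<in> carrier Y. vnorm Y y \<le> 1}. norm (f y))\<rparr>"

definition adjoint_operator ::
  "('k::{real_normed_field,euclidean_space}, 'y) normed_module \<Rightarrow> ('y \<Rightarrow> 'y)
     \<Rightarrow> ('y \<Rightarrow> 'k) \<Rightarrow> ('y \<Rightarrow> 'k)" where
  "adjoint_operator Y S f = (\<lambda>y\<in>carrier Y. f (S y))"

text \<open>
  \<open>X\<close> is the separable dual of \<open>Y\<close> and \<open>T\<close> is the adjoint of \<open>S\<close>, where the isometry \<open>J\<close>
  identifies \<open>X\<close> with \<open>Y\<^sup>*\<close>; literally \<open>X = dual_space Y\<close> is the case \<open>J = id\<close>. The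
  identification lets duals and arbitrary reflexive spaces share one type of vectors.
\<close>

definition adjoint_on_separable_dual ::
  "('k::{real_normed_field,euclidean_space}, 'y) normed_module \<Rightarrow> ('y \<Rightarrow> 'y)
     \<Rightarrow> ('x \<Rightarrow> 'y \<Rightarrow> 'k) \<Rightarrow> ('k, 'x) normed_module \<Rightarrow> ('x \<Rightarrow> 'x) \<Rightarrow> bool" where
  "adjoint_on_separable_dual Y S J X T \<longleftrightarrow>
     banach_space Y \<and> bounded_linear_map Y Y S \<and>
     banach_space X \<and> separable_space (norm_topology X) \<and> bounded_linear_map X X T \<and>
     isometric_isomorphism X (dual_space Y) J \<and>
     (\<forall>x\<in>carrier X. J (T x) = adjoint_operator Y S (J x))"

definition canonical_embedding ::
  "('k::{real_normed_field,euclidean_space}, 'x) normed_module \<Rightarrow> 'x \<Rightarrow> ('x \<Rightarrow> 'k) \<Rightarrow> 'k" where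
  "canonical_embedding X x = (\<lambda>f\<in>carrier (dual_space X). f x)"

definition reflexive_space ::
  "('k::{real_normed_field,euclidean_space}, 'x) normed_module \<Rightarrow> bool" where
  "reflexive_space X \<longleftrightarrow>
     banach_space X \<and>
     canonical_embedding X ` carrier X = carrier (dual_space (dual_space X))"


section \<open>Direct sums\<close>

text \<open>
  The algebraic direct sum over a finite index set \<open>I\<close> carrying the function \<open>p\<close> as its norm.
  Which \<open>p\<close> are admissible is the next definition.
\<close>

definition direct_sum ::
  "'i set \<Rightarrow> ('i \<Rightarrow> ('k, 'x) normed_module) \<Rightarrow> (('i \<Rightarrow> 'x) \<Rightarrow> real)
     \<Rightarrow> ('k, 'i \<Rightarrow> 'x) normed_module" where
  "direct_sum I X p =
     \<lparr>carrier = (\<Pi>\<^sub>E i\<in>I. carrier (X i)),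
      mult = undefined, one = undefined,
      zero = (\<lambda>i\<in>I. \<zero>\<^bsub>X i\<^esub>),
      add = (\<lambda>x y. \<lambda>i\<in>I. x i \<oplus>\<^bsub>X i\<^esub> y i),
      smult = (\<lambda>c x. \<lambda>i\<in>I. c \<odot>\<^bsub>X i\<^esub> x i),
      vnorm = p\<rparr>"

definition direct_sum_norm ::
  "'i set \<Rightarrow> ('i \<Rightarrow> ('k::{real_normed_field,euclidean_space}, 'x) normed_module)
     \<Rightarrow> (('i \<Rightarrow> 'x) \<Rightarrow> real) \<Rightarrow> bool" where
  "direct_sum_norm I X p \<longleftrightarrow>
     normed_vector_space (direct_sum I X p) \<and>
     norm_topology (direct_sum I X p) = product_topology (\<lambda>i. norm_topology (X i)) I"

definition direct_sum_operator :: "'i set \<Rightarrow> ('i \<Rightarrow> 'x \<Rightarrow> 'x) \<Rightarrow> ('i \<Rightarrow> 'x) \<Rightarrow> ('i \<Rightarrow> 'x)" where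
  "direct_sum_operator I T x = (\<lambda>i\<in>I. T i (x i))"


section \<open>Densities and recurrence\<close>

definition return_set :: "('x \<Rightarrow> 'x) \<Rightarrow> 'x \<Rightarrow> 'x set \<Rightarrow> nat set" where
  "return_set T x A = {n. (T ^^ n) x \<in> A}"

definition lower_density :: "nat set \<Rightarrow> ereal" where
  "lower_density A = liminf (\<lambda>N. ereal (real (card (A \<inter> {0..N})) / real (N + 1)))"

definition upper_density :: "nat set \<Rightarrow> ereal" where
  "upper_density A = limsup (\<lambda>N. ereal (real (card (A \<inter> {0..N})) / real (N + 1)))"

text \<open>The supremum is a maximum, since for fixed \<open>N\<close> the quotient takes at most \<open>N + 2\<close> values.\<close>

definition upper_banach_density :: "nat set \<Rightarrow> ereal" where
  "upper_banach_density A =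
     limsup (\<lambda>N. SUP m. ereal (real (card (A \<inter> {m..m + N})) / real (N + 1)))"

definition recurrent_points ::
  "(nat set \<Rightarrow> ereal) \<Rightarrow> ('k, 'x) normed_module \<Rightarrow> ('x \<Rightarrow> 'x) \<Rightarrow> 'x set" where
  "recurrent_points dens X T =
     {x \<in> carrier X. \<forall>U \<subseteq> carrier X.
        x \<in> norm_topology X interior_of U \<longrightarrow> 0 < dens (return_set T x U)}"

definition FRec :: "('k, 'x) normed_module \<Rightarrow> ('x \<Rightarrow> 'x) \<Rightarrow> 'x set" where
  "FRec = recurrent_points lower_density"

definition UFRec :: "('k, 'x) normed_module \<Rightarrow> ('x \<Rightarrow> 'x) \<Rightarrow> 'x set" where
  "UFRec = recurrent_points upper_density"

definition RRec :: "('k, 'x) normed_module \<Rightarrow> ('x \<Rightarrow> 'x) \<Rightarrow> 'x set" where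
  "RRec = recurrent_points upper_banach_density"

definition frequently_recurrent :: "('k, 'x) normed_module \<Rightarrow> ('x \<Rightarrow> 'x) \<Rightarrow> bool" where
  "frequently_recurrent X T \<longleftrightarrow> norm_topology X closure_of FRec X T = carrier X"

definition U_frequently_recurrent :: "('k, 'x) normed_module \<Rightarrow> ('x \<Rightarrow> 'x) \<Rightarrow> bool" where
  "U_frequently_recurrent X T \<longleftrightarrow> norm_topology X closure_of UFRec X T = carrier X"

definition reiteratively_recurrent :: "('k, 'x) normed_module \<Rightarrow> ('x \<Rightarrow> 'x) \<Rightarrow> bool" where
  "reiteratively_recurrent X T \<longleftrightarrow> norm_topology X closure_of RRec X T = carrier X"

end

theory Submission
  imports Defs "HOL-Probability.Probability"
begin

text \<open>
  The inclusion from left to right only projects: every return of the tuple is a return of each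
  coordinate, and positive lower density is stronger than positive upper Banach density. For the
  other inclusion a tuple of reiteratively recurrent points \<open>x\<^sub>i\<close> has to be approximated by a single
  frequently recurrent tuple. The return times of the different \<open>x\<^sub>i\<close> need not have anything in
  common, so the approximating tuple cannot be built from the orbits of the \<open>x\<^sub>i\<close> directly; it is
  a typical point of a product of invariant measures.

  Fix one operator \<open>T\<close>, a point \<open>x\<close> and a closed ball \<open>Q\<close> around \<open>x\<close>. The visits of the orbit to \<open>Q\<close>
  have positive upper Banach density, but in between the orbit may be unbounded, so averaging
  along the orbit in the space itself need not give a measure. Instead the visits are coded. At time
  \<open>n\<close> one records the bit that says whether \<open>T\<^sup>n x\<close> lies in \<open>Q\<close>, together with countably many bits
  that locate \<open>T\<^sup>n x\<close> with respect to weak-star closed half-spaces. On the compact space of all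
  such bit arrays, Furstenberg's correspondence principle (\<open>furstenberg_correspondence\<close>) yields
  a shift-invariant probability measure that is carried by the orbit closure of the code and
  gives positive mass to the arrays that start in \<open>Q\<close>. Because \<open>Q\<close> is weak-star compact, such an
  array is the code of exactly one point \<open>h \<omega>\<close> of \<open>Q\<close>, and because \<open>T\<close> is weak-star continuous,
  \<open>T\<^sup>n (h \<omega>) = h (shift\<^sup>n \<omega>)\<close> whenever both arrays start in \<open>Q\<close>
  (\<open>compact_evaluation.recurrence_model_exists\<close>). Norm separability makes the decoding map
  norm measurable and cuts its domain into countably many pieces with images of small diameter.

  Each of the finitely many operators now has such a model. The product of the measures is
  invariant under the coordinatewise shift, and in any probability-preserving system almost
  every point of a set returns to it with positive lower density
  (\<open>AE_positive_lower_density_returns\<close>). Applied to the countably many products of small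
  pieces this shows that almost every tuple of codes decodes to a frequently recurrent point
  (\<open>frequently_recurrent_tuple_exists\<close>), and that point is as close to \<open>(x\<^sub>i)\<close> as desired.

  For an adjoint on a separable dual the weak-star data are part of the hypothesis. If \<open>X\<close> is
  reflexive, it is the dual of its dual space and \<open>T\<close> is the adjoint of its adjoint; here
  separability is recovered by working in the closed linear span \<open>Z\<close> of the orbit, which is
  weakly closed by the Hahn-Banach theorem (\<open>reflexive_pairing\<close>).
\<close>

section \<open>Densities\<close>

lemma lower_density_posI:
  assumes "0 < c" "\<And>N. c * real (N + 1) \<le> real (card (A \<inter> {0..N}))"
  shows "0 < lower_density A"
proof -
  have "ereal c \<le> lower_density A"
    unfolding lower_density_def
    by (intro Liminf_bounded always_eventually allI) (use assms(2) in \<open>simp add: field_simps\<close>)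
  then show ?thesis
    using assms(1) by (meson ereal_less(2) less_le_trans)
qed

lemma lower_density_mono: "A \<subseteq> B \<Longrightarrow> lower_density A \<le> lower_density B"
  unfolding lower_density_def
  by (intro Liminf_mono always_eventually allI) (auto intro!: divide_right_mono card_mono)

lemma upper_banach_density_mono: "A \<subseteq> B \<Longrightarrow> upper_banach_density A \<le> upper_banach_density B"
  unfolding upper_banach_density_def
  by (intro Limsup_mono always_eventually allI SUP_mono') (auto intro!: divide_right_mono card_mono)

lemma lower_density_le_upper_density: "lower_density A \<le> upper_density A"
  unfolding lower_density_def upper_density_def by (intro Liminf_le_Limsup) simp

lemma upper_density_le_upper_banach_density: "upper_density A \<le> upper_banach_density A"
  unfolding upper_density_def upper_banach_density_def
proof (intro Limsup_mono always_eventually allI)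
  fix N
  show "ereal (real (card (A \<inter> {0..N})) / real (N + 1))
     \<le> (SUP m. ereal (real (card (A \<inter> {m..m + N})) / real (N + 1)))"
    by (rule SUP_upper2[of 0]) auto
qed

lemma upper_banach_density_posD:
  assumes "0 < upper_banach_density A"
  obtains \<delta> where "0 < \<delta>"
    "\<And>k. \<exists>N\<ge>k. \<exists>m. \<delta> * real (N + 1) \<le> real (card (A \<inter> {m..m + N}))"
proof -
  obtain d where d: "0 < ereal d" "ereal d < upper_banach_density A"
    using ereal_dense2[OF assms] by blast
  have "\<exists>N\<ge>k. \<exists>m. d * real (N + 1) \<le> real (card (A \<inter> {m..m + N}))" for k
  proof -
    have "\<exists>\<^sub>F N in sequentially. ereal d < (SUP m. ereal (real (card (A \<inter> {m..m + N})) / real (N + 1)))"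
      using d(2) unfolding upper_banach_density_def
      using Limsup_bounded[of "\<lambda>N. SUP m. ereal (real (card (A \<inter> {m..m + N})) / real (N + 1))" "ereal d" sequentially]
      unfolding frequently_def not_less by (meson not_less)
    then obtain N where N: "N \<ge> k"
        "ereal d < (SUP m. ereal (real (card (A \<inter> {m..m + N})) / real (N + 1)))"
      by (auto simp: frequently_sequentially)
    then obtain m where "ereal d < ereal (real (card (A \<inter> {m..m + N})) / real (N + 1))"
      by (auto simp: less_SUP_iff)
    then have "d * real (N + 1) \<le> real (card (A \<inter> {m..m + N}))"
      by (simp add: field_simps)
    with N(1) show ?thesis by blast
  qed
  with d(1) show thesis
    by (intro that[of d]) auto
qed

text \<open>
  The relative frequencies along intervals whose lengths tend to infinity and which see \<open>A\<close> with
  frequency at least \<open>\<delta>\<close> form a sequence in the compact space of functions from \<open>nat set\<close> to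
  \<open>{0..1}\<close>. Any cluster point will do: each of the required properties says that finitely many
  coordinates satisfy a closed condition, and the frequencies satisfy it, exactly or (shift
  invariance) up to an error that tends to zero.
\<close>

lemma invariant_mean_exists:
  assumes "0 < upper_banach_density A"
  obtains m :: "nat set \<Rightarrow> real"
  where "\<And>B. 0 \<le> m B" "m UNIV = 1" "\<And>B C. B \<inter> C = {} \<Longrightarrow> m (B \<union> C) = m B + m C"
    "\<And>B. m {n. Suc n \<in> B} = m B" "0 < m A"
proof -
  obtain \<delta> where \<delta>: "0 < \<delta>" "\<And>k. \<exists>N\<ge>k. \<exists>m. \<delta> * real (N + 1) \<le> real (card (A \<inter> {m..m + N}))"
    using upper_banach_density_posD[OF assms] by metis
  then obtain L s where Ls: "\<And>k. L k \<ge> k"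
      "\<And>k. \<delta> * real (L k + 1) \<le> real (card (A \<inter> {s k..s k + L k}))"
    by metis
  define fr where "fr k B = real (card (B \<inter> {s k..s k + L k})) / real (L k + 1)" for k B
  have fr01: "fr k B \<in> {0..1}" for k B
  proof -
    have "card (B \<inter> {s k..s k + L k}) \<le> card {s k..s k + L k}"
      by (intro card_mono) auto
    then show ?thesis by (auto simp: fr_def)
  qed
  have cpt: "compact (PiE UNIV (\<lambda>_::nat set. {0..1::real}))"
    using compactin_PiE[where I = UNIV and X = "\<lambda>_. euclidean" and S = "\<lambda>_::nat set. {0..1::real}"]
    by (simp add: euclidean_product_topology)
  have "PiE UNIV (\<lambda>_::nat set. {0..1::real}) \<inter> (\<Inter>k. closure (fr ` {k..})) \<noteq> {}"
  proof (rule compact_imp_fip_image[OF cpt])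
    fix I' :: "nat set" assume "finite I'"
    then obtain k where k: "\<And>i. i \<in> I' \<Longrightarrow> i \<le> k"
      using finite_nat_set_iff_bounded_le by auto
    have "fr k \<in> closure (fr ` {i..})" if "i \<in> I'" for i
      using k[OF that] by (intro subsetD[OF closure_subset]) auto
    then have "fr k \<in> PiE UNIV (\<lambda>_. {0..1}) \<inter> (\<Inter>i\<in>I'. closure (fr ` {i..}))"
      using fr01 by (auto simp: PiE_UNIV_domain)
    then show "PiE UNIV (\<lambda>_. {0..1}) \<inter> (\<Inter>i\<in>I'. closure (fr ` {i..})) \<noteq> {}"
      by blast
  qed auto
  then obtain m where m: "\<And>k. m \<in> closure (fr ` {k..})"
    by auto
  have closed_prop: "P m" if "closed (Collect P)" "\<And>j. j \<ge> k \<Longrightarrow> P (fr j)" for P k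
    using closure_minimal[of "fr ` {k..}" "Collect P"] that m[of k] by auto
  show thesis
  proof
    show "0 \<le> m B" for B
      by (rule closed_prop[of _ 0]) (use fr01 in \<open>auto intro!: closed_Collect_le continuous_intros\<close>)
    show "m UNIV = 1"
      by (rule closed_prop[of _ 0]) (auto simp: fr_def intro!: closed_Collect_eq continuous_intros)
    show "m (B \<union> C) = m B + m C" if "B \<inter> C = {}" for B C
    proof (rule closed_prop[of _ 0])
      show "fr j (B \<union> C) = fr j B + fr j C" for j
      proof -
        have "card ((B \<union> C) \<inter> {s j..s j + L j})
            = card (B \<inter> {s j..s j + L j}) + card (C \<inter> {s j..s j + L j})"
          unfolding Int_Un_distrib2 using that by (intro card_Un_disjoint) auto
        then show ?thesis by (simp add: fr_def add_divide_distrib)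
      qed
    qed (auto intro!: closed_Collect_eq continuous_intros)
    show "0 < m A"
    proof -
      have "\<delta> \<le> m A"
        by (rule closed_prop[of _ 0])
          (use Ls(2) in \<open>auto simp: fr_def field_simps intro!: closed_Collect_le continuous_intros\<close>)
      with \<delta>(1) show ?thesis by linarith
    qed
    show "m {n. Suc n \<in> B} = m B" for B
    proof -
      \<comment> \<open>Moving the window by one changes the count by at most one.\<close>
      have "\<bar>m {n. Suc n \<in> B} - m B\<bar> \<le> 1 / real (k + 1)" for k
      proof (rule closed_prop[of _ k])
        fix j assume "j \<ge> k"
        have 1: "card ({n. Suc n \<in> B} \<inter> {s j..s j + L j}) = card (B \<inter> {Suc (s j)..Suc (s j + L j)})"
        proof -
          have "Suc ` ({n. Suc n \<in> B} \<inter> {s j..s j + L j}) = B \<inter> {Suc (s j)..Suc (s j + L j)}"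
          proof (intro subset_antisym subsetI)
            fix n assume "n \<in> B \<inter> {Suc (s j)..Suc (s j + L j)}"
            then show "n \<in> Suc ` ({n. Suc n \<in> B} \<inter> {s j..s j + L j})"
              by (intro image_eqI[of _ _ "n - 1"]) auto
          qed auto
          then show ?thesis by (metis card_image inj_Suc inj_on_subset subset_UNIV)
        qed
        have 2: "card (B \<inter> {Suc (s j)..Suc (s j + L j)}) \<le> card (B \<inter> {s j..s j + L j}) + 1"
        proof -
          have "card (B \<inter> {Suc (s j)..Suc (s j + L j)}) \<le> card (insert (Suc (s j + L j)) (B \<inter> {s j..s j + L j}))"
            by (intro card_mono) auto
          also have "\<dots> \<le> card (B \<inter> {s j..s j + L j}) + 1"
            by (simp add: card_insert_if)
          finally show ?thesis .
        qed
        have 3: "card (B \<inter> {s j..s j + L j}) \<le> card (B \<inter> {Suc (s j)..Suc (s j + L j)}) + 1"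
        proof -
          have "card (B \<inter> {s j..s j + L j}) \<le> card (insert (s j) (B \<inter> {Suc (s j)..Suc (s j + L j)}))"
            by (intro card_mono) auto
          also have "\<dots> \<le> card (B \<inter> {Suc (s j)..Suc (s j + L j)}) + 1"
            by (simp add: card_insert_if)
          finally show ?thesis .
        qed
        have "\<bar>fr j {n. Suc n \<in> B} - fr j B\<bar> =
            \<bar>real (card (B \<inter> {Suc (s j)..Suc (s j + L j)})) - real (card (B \<inter> {s j..s j + L j}))\<bar> / real (L j + 1)"
          unfolding fr_def 1 by (simp add: diff_divide_distrib[symmetric])
        also have "\<dots> \<le> 1 / real (L j + 1)"
          using 2 3 by (intro divide_right_mono) auto
        also have "\<dots> \<le> 1 / real (k + 1)"
          using Ls(1)[of j] \<open>j \<ge> k\<close> by (intro divide_left_mono) auto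
        finally show "\<bar>fr j {n. Suc n \<in> B} - fr j B\<bar> \<le> 1 / real (k + 1)" .
      qed (auto intro!: closed_Collect_le continuous_intros)
      then have "\<not> 0 < \<bar>m {n. Suc n \<in> B} - m B\<bar>"
        by (metis Suc_eq_plus1 nat_approx_posE not_less)
      then show ?thesis by simp
    qed
  qed
qed

section \<open>Positive lower density of returns\<close>

text \<open>
  This is weaker than the pointwise ergodic theorem and needs only its covering argument. Let
  \<open>E\<close> be the set of points whose visit frequencies to \<open>D\<close> come arbitrarily close to \<open>0\<close>; every
  other point has positive lower density. Fix a small frequency \<open>1 / Suc j\<close>. An orbit segment
  of length \<open>n\<close> can be cut greedily: whenever it is at a point that has a sparse stretch
  of length at most \<open>L\<close> (the set \<open>G j L\<close>), skip that stretch; otherwise move on by one step. Hence its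
  visits to \<open>E \<inter> D\<close> number at most \<open>n / Suc j\<close>, plus the visits to \<open>E - G j L\<close>, plus
  \<open>L\<close> for the end. Integrating, letting \<open>n\<close>, then \<open>L\<close>, then \<open>j\<close> tend to infinity shows that
  \<open>E \<inter> D\<close> is a null set.
\<close>

lemma (in prob_space) AE_positive_lower_density_returns:
  assumes f[measurable]: "f \<in> measurable M M" and inv: "distr M M f = M" and D[measurable]: "D \<in> sets M"
  shows "AE x in M. x \<in> D \<longrightarrow> 0 < lower_density (return_set f x D)"
proof -
  define cnt where "cnt B n x = (\<Sum>k<n. indicator B ((f ^^ k) x) :: real)" for B n x
  have fk[measurable]: "(f ^^ k) \<in> measurable M M" for k
    by (induction k) (auto simp: funpow.simps)
  have distr_fk: "distr M M (f ^^ k) = M" for k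
  proof (induction k)
    case (Suc k)
    have "distr M M (f ^^ Suc k) = distr (distr M M (f ^^ k)) M f"
      by (subst distr_distr) auto
    with Suc inv show ?case by metis
  qed (simp add: distr_id)
  have cnt_meas[measurable]: "cnt B n \<in> borel_measurable M" if [measurable]: "B \<in> sets M" for B n
    unfolding cnt_def by measurable
  have int_cnt: "integrable M (cnt B n)" "(\<integral>x. cnt B n x \<partial>M) = n * prob B" if [measurable]: "B \<in> sets M" for B n
  proof -
    have ind: "integrable M (\<lambda>x. indicator B ((f ^^ k) x) :: real)" for k
      by (rule integrable_const_bound[of _ 1]) auto
    then show "integrable M (cnt B n)"
      unfolding cnt_def by auto
    have "(\<integral>x. indicator B ((f ^^ k) x) \<partial>M) = prob B" for k
    proof -
      have "(\<integral>x. indicator B ((f ^^ k) x) \<partial>M) = (\<integral>x. (indicator B x :: real) \<partial>distr M M (f ^^ k))"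
        by (subst integral_distr) auto
      also have "\<dots> = prob B"
        by (simp add: distr_fk)
      finally show ?thesis .
    qed
    then show "(\<integral>x. cnt B n x \<partial>M) = n * prob B"
      unfolding cnt_def using ind by (subst Bochner_Integration.integral_sum) auto
  qed
  define G where "G j L = {x \<in> space M. \<exists>n\<in>{1..L}. cnt D n x * Suc j < n}" for j L
  define E where "E = (\<Inter>j. \<Union>L. G j L)"
  have G[measurable]: "G j L \<in> sets M" for j L
    unfolding G_def by measurable
  have E[measurable]: "E \<in> sets M"
    unfolding E_def by measurable
  have cnt_split: "cnt B (n + k) x = cnt B n x + cnt B k ((f ^^ n) x)" for B n k x
    unfolding cnt_def
    by (induction k) (simp_all add: funpow_add[symmetric] add.commute flip: comp_apply[of "f ^^ _" "f ^^ _"])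
  have cnt_le: "cnt B n x \<le> n" for B n x
    unfolding cnt_def using sum_bounded_above[of "{..<n}" "\<lambda>k. indicator B ((f ^^ k) x)" "1::real"] by simp
  have cnt_mono: "cnt B n x \<le> cnt B' n x" if "B \<subseteq> B'" for B B' n x
    unfolding cnt_def using that by (intro sum_mono) (auto simp: indicator_def)
  have cnt_nonneg: "0 \<le> cnt B n x" for B n x
    unfolding cnt_def by (intro sum_nonneg) auto
  have tile: "Suc j * cnt (E \<inter> D) n x \<le> n + Suc j * cnt (E - G j L) n x + Suc j * real L" 
    if "x \<in> space M" for j L n x
    using that
  proof (induction n arbitrary: x rule: less_induct)
    case (less n)
    have fx: "(f ^^ k) x \<in> space M" for k
      using fk less.prems by (rule measurable_space)
    show ?case
    proof (cases "n \<le> L")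
      case True
      then have "cnt (E \<inter> D) n x \<le> L"
        using cnt_le[of "E \<inter> D" n x] by linarith
      then have "Suc j * cnt (E \<inter> D) n x \<le> Suc j * real L"
        by (intro mult_left_mono) auto
      with mult_nonneg_nonneg[of "real (Suc j)", OF _ cnt_nonneg[of "E - G j L" n x]] show ?thesis
        by linarith
    next
      case False
      show ?thesis
      proof (cases "x \<in> G j L")
        case True
        then obtain l where l: "1 \<le> l" "l \<le> L" "cnt D l x * Suc j < l"
          by (auto simp: G_def)
        have eq: "cnt B n x = cnt B l x + cnt B (n - l) ((f ^^ l) x)" for B
          using cnt_split[of B l "n - l" x] l False by simp
        have "Suc j * cnt (E \<inter> D) l x \<le> Suc j * cnt D l x"
          by (intro mult_left_mono cnt_mono) auto
        also have "\<dots> \<le> l"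
          using l(3) by (simp add: mult.commute)
        also have "\<dots> \<le> l + Suc j * cnt (E - G j L) l x"
          using cnt_nonneg[of "E - G j L" l x] by simp
        finally have 1: "Suc j * cnt (E \<inter> D) l x \<le> l + Suc j * cnt (E - G j L) l x" .
        have 2: "Suc j * cnt (E \<inter> D) (n - l) ((f ^^ l) x)
            \<le> (n - l) + Suc j * cnt (E - G j L) (n - l) ((f ^^ l) x) + Suc j * real L"
          using l False by (intro less.IH fx) auto
        have "real n = real l + real (n - l)" using l False by simp
        with 1 2 show ?thesis
          unfolding eq distrib_left by linarith
      next
        case notG: False
        have eq: "cnt B n x = indicator B x + cnt B (n - 1) (f x)" for B
          using cnt_split[of B 1 "n - 1" x] False by (simp add: cnt_def)
        have 1: "real (Suc j) * indicator (E \<inter> D) x \<le> real (Suc j) * indicator (E - G j L) x"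
          using notG by (intro mult_left_mono) (auto simp: indicator_def)
        have 2: "Suc j * cnt (E \<inter> D) (n - 1) (f x)
            \<le> (n - 1) + Suc j * cnt (E - G j L) (n - 1) (f x) + Suc j * real L"
          using False fx[of 1] by (intro less.IH) auto
        have "real (n - 1) \<le> real n" by simp
        with 1 2 show ?thesis
          unfolding eq distrib_left by linarith
      qed
    qed
  qed
  have int_tile: "Suc j * prob (E \<inter> D) \<le> 1 + Suc j * prob (E - G j L)" for j L
  proof -
    have *: "Suc j * (n * prob (E \<inter> D)) \<le> n + Suc j * (n * prob (E - G j L)) + Suc j * real L" for n :: nat
    proof -
      have "(\<integral>x. Suc j * cnt (E \<inter> D) n x \<partial>M)
          \<le> (\<integral>x. n + Suc j * cnt (E - G j L) n x + Suc j * real L \<partial>M)"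
        using tile int_cnt(1) by (intro integral_mono) auto
      then show ?thesis
        using int_cnt by (simp add: prob_space)
    qed
    have "Suc j * prob (E \<inter> D) \<le> 1 + Suc j * prob (E - G j L) + Suc j * real L * inverse (real (Suc n))" for n
      using *[of "Suc n"] by (simp add: field_simps)
    moreover have "(\<lambda>n. 1 + Suc j * prob (E - G j L) + Suc j * real L * inverse (real (Suc n)))
        \<longlonglongrightarrow> 1 + Suc j * prob (E - G j L) + Suc j * real L * 0"
      by (intro tendsto_intros LIMSEQ_inverse_real_of_nat)
    ultimately show ?thesis
      using LIMSEQ_le_const by fastforce
  qed
  have small: "Suc j * prob (E \<inter> D) \<le> 1" for j
  proof -
    have "(\<lambda>L. prob (E - G j L)) \<longlonglongrightarrow> prob (\<Inter>L. E - G j L)"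
      by (intro finite_Lim_measure_decseq) (auto simp: decseq_def G_def)
    also have "(\<Inter>L. E - G j L) = {}"
      by (auto simp: E_def)
    finally have "(\<lambda>L. 1 + real (Suc j) * prob (E - G j L)) \<longlonglongrightarrow> 1 + real (Suc j) * 0"
      by (intro tendsto_intros) simp
    with int_tile show ?thesis
      using LIMSEQ_le_const by fastforce
  qed
  have "prob (E \<inter> D) \<le> inverse (real (Suc j))" for j
    using small[of j] by (simp add: field_simps)
  then have "prob (E \<inter> D) \<le> 0"
    by (intro LIMSEQ_le_const[OF LIMSEQ_inverse_real_of_nat]) auto
  then have "emeasure M (E \<inter> D) = 0"
    by (simp add: emeasure_eq_measure measure_le_0_iff)
  then have "AE x in M. x \<notin> E \<inter> D"
    by (intro AE_not_in) (auto simp: null_sets_def)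
  with AE_space show ?thesis
  proof eventually_elim
    case (elim x)
    show ?case
    proof
      assume "x \<in> D"
      with elim obtain j where j: "\<And>L. x \<notin> G j L"
        by (auto simp: E_def)
      have *: "real n \<le> cnt D n x * Suc j" if "n \<ge> 1" for n
        using j[of n] elim that by (force simp: G_def not_less)
      have "cnt D (N + 1) x = card (return_set f x D \<inter> {0..N})" for N
      proof -
        have "cnt D (N + 1) x = (\<Sum>k\<in>{k\<in>{..<N+1}. (f ^^ k) x \<in> D}. 1)"
          unfolding cnt_def by (intro sum.mono_neutral_cong_right) (auto simp: indicator_def)
        also have "\<dots> = card {k\<in>{..<N+1}. (f ^^ k) x \<in> D}"
          by (simp only: sum_constant mult_1_right)
        also have "{k\<in>{..<N+1}. (f ^^ k) x \<in> D} = return_set f x D \<inter> {0..N}"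
          by (auto simp: return_set_def)
        finally show ?thesis .
      qed
      then show "0 < lower_density (return_set f x D)"
        using *[of "Suc _"] by (intro lower_density_posI[of "1 / Suc j"]) (auto simp: field_simps)
    qed
  qed
qed

section \<open>The Furstenberg correspondence\<close>

definition shift :: "(nat \<Rightarrow> 'a) \<Rightarrow> nat \<Rightarrow> 'a" where
  "shift \<omega> = (\<lambda>n. \<omega> (Suc n))"

lemma funpow_shift: "(shift ^^ n) \<omega> = (\<lambda>i. \<omega> (n + i))"
  by (induction n) (auto simp: shift_def)

text \<open>
  The elements of the space \<open>nat \<Rightarrow> nat \<Rightarrow> bool\<close> are read as sequences in time (first index) of
  infinite binary words (second index). Only the square of side \<open>N\<close> may matter for the sets below,
  so that a single number bounds both the time and the length of the words that are inspected.
\<close>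

definition determined_by :: "nat \<Rightarrow> (nat \<Rightarrow> nat \<Rightarrow> bool) set \<Rightarrow> bool" where
  "determined_by N A \<longleftrightarrow>
     (\<forall>\<omega> \<omega>'. (\<forall>i<N. \<forall>j<N. \<omega> i j = \<omega>' i j) \<longrightarrow> (\<omega> \<in> A \<longleftrightarrow> \<omega>' \<in> A))"

definition cylinders :: "(nat \<Rightarrow> nat \<Rightarrow> bool) set set" where
  "cylinders = {A. \<exists>N. determined_by N A}"

lemma determined_byI:
  assumes "\<And>\<omega> \<omega>'. (\<And>i j. i < N \<Longrightarrow> j < N \<Longrightarrow> \<omega> i j = \<omega>' i j) \<Longrightarrow> \<omega> \<in> A \<Longrightarrow> \<omega>' \<in> A"
  shows "determined_by N A"
  unfolding determined_by_def by (intro allI impI iffI) (auto intro: assms)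

lemma determined_byD:
  "determined_by N A \<Longrightarrow> (\<And>i j. i < N \<Longrightarrow> j < N \<Longrightarrow> \<omega> i j = \<omega>' i j) \<Longrightarrow> \<omega> \<in> A \<longleftrightarrow> \<omega>' \<in> A"
  unfolding determined_by_def by blast

lemma determined_by_mono: "determined_by N A \<Longrightarrow> N \<le> N' \<Longrightarrow> determined_by N' A"
  unfolding determined_by_def[of N'] by (intro allI impI, rule determined_byD[of N]) auto

lemma cylinders_common:
  assumes "A \<in> cylinders" "B \<in> cylinders"
  obtains N where "determined_by N A" "determined_by N B"
proof -
  obtain K L where "determined_by K A" "determined_by L B"
    using assms by (auto simp: cylinders_def)
  then show thesis
    by (intro that[of "max K L"]) (auto elim: determined_by_mono)
qed

lemma cylinder_coordinate: "{\<omega>. \<omega> i j} \<in> cylinders"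
  unfolding cylinders_def determined_by_def by (auto intro!: exI[of _ "Suc (max i j)"])

lemma ring_of_sets_cylinders: "ring_of_sets UNIV cylinders"
  unfolding ring_of_sets_iff
proof (intro conjI ballI)
  show "{} \<in> cylinders" by (auto simp: cylinders_def determined_by_def)
  fix A B assume "A \<in> cylinders" "B \<in> cylinders"
  then obtain N where N: "determined_by N A" "determined_by N B"
    by (rule cylinders_common)
  have "determined_by N (A \<union> B)" "determined_by N (A - B)"
    using determined_byD[OF N(1)] determined_byD[OF N(2)] by (auto intro!: determined_byI)
  then show "A \<union> B \<in> cylinders" "A - B \<in> cylinders"
    by (auto simp: cylinders_def)
qed auto

lemma Int_stable_cylinders: "Int_stable cylinders"
proof (rule Int_stableI)
  fix A B assume "A \<in> cylinders" "B \<in> cylinders"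
  then obtain N where N: "determined_by N A" "determined_by N B"
    by (rule cylinders_common)
  have "determined_by N (A \<inter> B)"
    using determined_byD[OF N(1)] determined_byD[OF N(2)] by (auto intro!: determined_byI)
  then show "A \<inter> B \<in> cylinders" by (auto simp: cylinders_def)
qed

lemma vimage_shift_cylinders:
  assumes "A \<in> cylinders"
  shows "shift -` A \<in> cylinders"
proof -
  obtain N where N: "determined_by N A" using assms by (auto simp: cylinders_def)
  have "determined_by (Suc N) (shift -` A)"
    unfolding determined_by_def vimage_eq
    by (intro allI impI determined_byD[OF N]) (auto simp: shift_def)
  then show ?thesis by (auto simp: cylinders_def)
qed

lemma closed_cylinder:
  assumes "A \<in> cylinders"
  shows "closed A"
proof -
  obtain N where N: "determined_by N A" using assms by (auto simp: cylinders_def)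
  have "open (- A)"
    unfolding open_subopen[of "- A"]
  proof
    fix \<omega> assume "\<omega> \<in> - A"
    define V where "V = (\<Inter>(i, j)\<in>{..<N} \<times> {..<N}. {\<omega>'. \<omega>' i j = \<omega> i j})"
    have "open {\<omega>'. \<omega>' i j = \<omega> i j}" for i j
    proof -
      have "continuous_on UNIV (\<lambda>\<omega>'::nat \<Rightarrow> nat \<Rightarrow> bool. \<omega>' i j)"
        by (rule continuous_on_product_then_coordinatewise[OF continuous_on_product_coordinates])
      then have "open ((\<lambda>\<omega>'::nat \<Rightarrow> nat \<Rightarrow> bool. \<omega>' i j) -` {\<omega> i j})"
        by (intro open_vimage discrete_topology_class.open_discrete)
      then show ?thesis by (simp add: vimage_def)
    qed
    then have "open V"
      unfolding V_def by (intro open_INT) auto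
    moreover have "V \<subseteq> - A"
    proof
      fix \<omega>' assume "\<omega>' \<in> V"
      then have "\<omega>' \<in> A \<longleftrightarrow> \<omega> \<in> A"
        by (intro determined_byD[OF N]) (auto simp: V_def)
      with \<open>\<omega> \<in> - A\<close> show "\<omega>' \<in> - A" by auto
    qed
    ultimately show "\<exists>T. open T \<and> \<omega> \<in> T \<and> T \<subseteq> - A"
      by (intro exI[of _ V]) (auto simp: V_def)
  qed
  then show ?thesis by (simp add: closed_def)
qed

lemma compact_UNIV_codes: "compact (UNIV :: (nat \<Rightarrow> nat \<Rightarrow> bool) set)"
proof -
  have bool: "compact (UNIV :: bool set)"
    by (intro finite_imp_compact) auto
  have "compact (UNIV :: (nat \<Rightarrow> bool) set)"
    using bool compactin_PiE[where I = UNIV and X = "\<lambda>_. euclidean" and S = "\<lambda>_::nat. UNIV :: bool set"]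
    by (simp add: euclidean_product_topology)
  then show ?thesis
    using compactin_PiE[where I = UNIV and X = "\<lambda>_. euclidean" and S = "\<lambda>_::nat. UNIV :: (nat \<Rightarrow> bool) set"]
    by (simp add: euclidean_product_topology)
qed

text \<open>
  Measure a cylinder by the invariant mean of the times at which the shifted array \<open>w\<close> lies in it.
  This set function is additive, and since cylinders are clopen in a compact space, a decreasing
  sequence of them with empty intersection is eventually empty. So Caratheodory's theorem extends
  it to a measure. The set of arrays whose square of side \<open>N\<close> occurs somewhere in \<open>w\<close> is a
  cylinder that contains every shift of \<open>w\<close>, hence has full measure.
\<close>

lemma furstenberg_correspondence:
  fixes w :: "nat \<Rightarrow> nat \<Rightarrow> bool"
  assumes "0 < upper_banach_density {n. w n 0}"
  obtains \<nu> where "prob_space \<nu>" "space \<nu> = UNIV" "sets \<nu> = sigma_sets UNIV cylinders"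
    "shift \<in> measurable \<nu> \<nu>" "distr \<nu> \<nu> shift = \<nu>" "0 < measure \<nu> {\<omega>. \<omega> 0 0}"
    "AE \<omega> in \<nu>. \<forall>N. \<exists>n. \<forall>i<N. \<forall>j<N. \<omega> i j = w (n + i) j"
proof -
  obtain m :: "nat set \<Rightarrow> real" where m: "\<And>B. 0 \<le> m B" "m UNIV = 1"
      "\<And>B C. B \<inter> C = {} \<Longrightarrow> m (B \<union> C) = m B + m C" "\<And>B. m {n. Suc n \<in> B} = m B" "0 < m {n. w n 0}"
    using invariant_mean_exists[OF assms] by blast
  interpret R: ring_of_sets UNIV cylinders by (rule ring_of_sets_cylinders)
  define orb where "orb n = (\<lambda>i. w (n + i))" for n
  define f where "f A = ennreal (m {n. orb n \<in> A})" for A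
  have m0: "m {} = 0" using m(3)[of "{}" "{}"] by simp
  have "\<exists>\<mu> :: (nat \<Rightarrow> nat \<Rightarrow> bool) set \<Rightarrow> ennreal.
      (\<forall>s \<in> cylinders. \<mu> s = f s) \<and> measure_space UNIV (sigma_sets UNIV cylinders) \<mu>"
  proof (rule R.caratheodory_empty_continuous)
    show "positive cylinders f"
      by (auto simp: positive_def f_def m0)
    show "additive cylinders f"
    proof (unfold additive_def, intro ballI impI)
      fix A B :: "(nat \<Rightarrow> nat \<Rightarrow> bool) set" assume "A \<inter> B = {}"
      then have "{n. orb n \<in> A} \<inter> {n. orb n \<in> B} = {}" by auto
      from m(3)[OF this] show "f (A \<union> B) = f A + f B"
        by (simp add: f_def Collect_disj_eq m(1) flip: ennreal_plus)
    qed
    show "f A \<noteq> \<infinity>" for A by (simp add: f_def)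
    fix A :: "nat \<Rightarrow> (nat \<Rightarrow> nat \<Rightarrow> bool) set"
    assume A: "range A \<subseteq> cylinders" "decseq A" "(\<Inter>i. A i) = {}"
    have "\<exists>i. A i = {}"
    proof (rule ccontr)
      assume ne: "\<not> (\<exists>i. A i = {})"
      have "UNIV \<inter> (\<Inter>i. A i) \<noteq> {}"
      proof (rule compact_imp_fip_image[OF compact_UNIV_codes])
        show "closed (A i)" for i using A(1) by (intro closed_cylinder) auto
        fix I' :: "nat set" assume "finite I'"
        then obtain k where k: "\<And>i. i \<in> I' \<Longrightarrow> i \<le> k"
          using finite_nat_set_iff_bounded_le by auto
        have "A k \<subseteq> (\<Inter>i\<in>I'. A i)"
          using k A(2) by (auto simp: decseq_def)
        with ne show "UNIV \<inter> (\<Inter>i\<in>I'. A i) \<noteq> {}" by blast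
      qed
      with A(3) show False by simp
    qed
    then obtain i where "A i = {}" by blast
    then have "A k = {}" if "k \<ge> i" for k
      using A(2) that by (force simp: decseq_def)
    then have "eventually (\<lambda>k. f (A k) = 0) sequentially"
      unfolding eventually_sequentially by (intro exI[of _ i]) (simp add: f_def m0)
    then show "(\<lambda>i. f (A i)) \<longlonglongrightarrow> 0"
      by (rule tendsto_eventually)
  qed
  then obtain \<mu> where \<mu>: "\<And>A. A \<in> cylinders \<Longrightarrow> \<mu> A = f A"
      "measure_space UNIV (sigma_sets UNIV cylinders) \<mu>" by blast
  define \<nu> where "\<nu> = measure_of UNIV cylinders \<mu>"
  have sp: "space \<nu> = UNIV" and st: "sets \<nu> = sigma_sets UNIV cylinders"
    by (simp_all add: \<nu>_def space_measure_of_conv sets_measure_of)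
  have em: "emeasure \<nu> A = f A" if "A \<in> cylinders" for A
  proof -
    have "emeasure \<nu> A = \<mu> A"
      by (rule emeasure_measure_of[OF \<nu>_def])
        (use \<mu>(2) that st in \<open>auto simp: measure_space_def sigma_sets.Basic\<close>)
    with \<mu>(1)[OF that] show ?thesis by simp
  qed
  have UNIV_cyl: "UNIV \<in> cylinders" by (auto simp: cylinders_def determined_by_def)
  have "emeasure \<nu> (space \<nu>) = 1"
    using em[OF UNIV_cyl] by (simp add: sp f_def m(2))
  then interpret \<nu>: prob_space \<nu> by (rule prob_spaceI)
  have cyl_sets: "A \<in> sets \<nu>" if "A \<in> cylinders" for A
    using that by (auto simp: st)
  have shift_meas: "shift \<in> measurable \<nu> \<nu>"
    by (rule measurable_sigma_sets[OF st])
      (auto simp: sp intro!: cyl_sets vimage_shift_cylinders)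
  have inv: "distr \<nu> \<nu> shift = \<nu>"
  proof (rule measure_eqI_generator_eq[OF Int_stable_cylinders, of UNIV])
    fix A assume A: "A \<in> cylinders"
    have "emeasure (distr \<nu> \<nu> shift) A = emeasure \<nu> (shift -` A)"
      using A by (simp add: emeasure_distr[OF shift_meas] cyl_sets sp)
    also have "\<dots> = ennreal (m {n. shift (orb n) \<in> A})"
      using em[OF vimage_shift_cylinders[OF A]] by (simp add: f_def)
    also have "{n. shift (orb n) \<in> A} = {n. Suc n \<in> {n. orb n \<in> A}}"
      by (auto simp: shift_def orb_def)
    also have "ennreal (m \<dots>) = emeasure \<nu> A"
      unfolding m(4) using em[OF A] by (simp add: f_def)
    finally show "emeasure (distr \<nu> \<nu> shift) A = emeasure \<nu> A" .
  next
    show "range (\<lambda>_::nat. UNIV) \<subseteq> cylinders" using UNIV_cyl by auto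
    show "emeasure (distr \<nu> \<nu> shift) UNIV \<noteq> \<infinity>"
      using \<nu>.prob_space_distr[OF shift_meas] by (metis infinity_ennreal_def prob_space.emeasure_le_1 top.not_eq_extremum ennreal_one_less_top le_less_trans order_less_irrefl)
  qed (auto simp: st)
  have pos: "0 < measure \<nu> {\<omega>. \<omega> 0 0}"
  proof -
    have "emeasure \<nu> {\<omega>. \<omega> 0 0} = ennreal (m {n. w n 0})"
      using em[OF cylinder_coordinate] by (simp add: f_def orb_def)
    with m(1,5) show ?thesis by (simp add: measure_def)
  qed
  have "AE \<omega> in \<nu>. \<exists>n. \<forall>i<N. \<forall>j<N. \<omega> i j = w (n + i) j" for N
  proof -
    define A where "A = {\<omega>. \<exists>n. \<forall>i<N. \<forall>j<N. \<omega> i j = w (n + i) j}"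
    have "determined_by N A"
      unfolding determined_by_def A_def by auto
    then have A: "A \<in> cylinders" by (auto simp: cylinders_def)
    have "{n. orb n \<in> A} = UNIV" by (auto simp: A_def orb_def)
    then have "emeasure \<nu> A = 1" using em[OF A] by (simp add: f_def m(2))
    then have "AE \<omega> in \<nu>. \<omega> \<in> A"
      using \<nu>.AE_in_set_eq_1[OF cyl_sets[OF A]] by (simp add: measure_def)
    then show ?thesis by (simp add: A_def)
  qed
  then have "AE \<omega> in \<nu>. \<forall>N. \<exists>n. \<forall>i<N. \<forall>j<N. \<omega> i j = w (n + i) j"
    by (simp add: AE_all_countable)
  from that[OF \<nu>.prob_space_axioms sp st shift_meas inv pos this] show thesis .
qed

section \<open>From invariant measures to frequently recurrent tuples\<close>

text \<open>
  A measure-preserving system that models part of the dynamics of \<open>T\<close> by a decoding map \<open>h\<close>. The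
  map is defined on \<open>A\<close> only, and it intertwines \<open>\<sigma>\<close> and \<open>T\<close> only between times at which the orbit
  is in \<open>A\<close>. The last condition is what remains of measurability and separability of the
  range of \<open>h\<close>.
\<close>

locale recurrence_model = prob_space \<nu> for \<nu> :: "'w measure" +
  fixes \<sigma> :: "'w \<Rightarrow> 'w" and A :: "'w set" and h :: "'w \<Rightarrow> 'x"
    and Q :: "'x set" and d :: "'x \<Rightarrow> 'x \<Rightarrow> real" and T :: "'x \<Rightarrow> 'x"
  assumes meas_\<sigma>: "\<sigma> \<in> measurable \<nu> \<nu>"
    and invariant: "distr \<nu> \<nu> \<sigma> = \<nu>"
    and sets_A: "A \<in> sets \<nu>"
    and pos_A: "0 < measure \<nu> A"
    and h_in: "\<omega> \<in> A \<Longrightarrow> h \<omega> \<in> Q"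
    and equivariant: "\<omega> \<in> A \<Longrightarrow> (\<sigma> ^^ n) \<omega> \<in> A \<Longrightarrow> (T ^^ n) (h \<omega>) = h ((\<sigma> ^^ n) \<omega>)"
    and fine_pieces: "\<exists>\<D>. countable \<D> \<and> \<D> \<subseteq> sets \<nu> \<and> (\<forall>D\<in>\<D>. D \<subseteq> A) \<and>
      (\<forall>\<omega>\<in>A. \<forall>\<eta>>0. \<exists>D\<in>\<D>. \<omega> \<in> D \<and> (\<forall>\<omega>'\<in>D. d (h \<omega>) (h \<omega>') < \<eta>))"

text \<open>
  Almost every \<open>\<omega>\<close> in the product of the \<open>\<nu> i\<close> returns with positive lower density to every
  product of fine pieces that contains it, since there are only countably many of these. A
  simultaneous return of all coordinates to their pieces is a return of the decoded tuple to a
  small neighbourhood of itself.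
\<close>

lemma frequently_recurrent_tuple_exists:
  fixes \<nu> :: "'i \<Rightarrow> 'w measure" and h :: "'i \<Rightarrow> 'w \<Rightarrow> 'x"
  assumes fin: "finite I"
    and model: "\<And>i. i \<in> I \<Longrightarrow> recurrence_model (\<nu> i) \<sigma> (A i) (h i) (Q i) (d i) (T i)"
  obtains y where "y \<in> (\<Pi>\<^sub>E i\<in>I. Q i)"
    "\<And>\<eta>. 0 < \<eta> \<Longrightarrow> 0 < lower_density {n. \<forall>i\<in>I. d i (y i) ((T i ^^ n) (y i)) < \<eta>}"
proof -
  have prob: "prob_space (\<nu> i)" if "i \<in> I" for i
    using model[OF that] by (simp add: recurrence_model_def)
  define P where "P = PiM I \<nu>"
  define F where "F = compose I \<sigma>"
  interpret P: prob_space P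
    unfolding P_def by (rule prob_space_PiM) (rule prob)
  have \<sigma>: "\<sigma> \<in> measurable (\<nu> i) (\<nu> i)" if "i \<in> I" for i
    using recurrence_model.meas_\<sigma>[OF model[OF that]] .
  have F: "F \<in> measurable P P"
    unfolding P_def F_def compose_def
    by (intro measurable_restrict measurable_compose[OF _ \<sigma>] measurable_component_singleton)
  have inv: "distr P P F = P"
    unfolding P_def F_def using fin prob \<sigma> recurrence_model.invariant[OF model]
    by (subst distr_PiM_finite_prob_space') (auto intro: PiM_cong)
  have box: "emeasure P (PiE I B) = (\<Prod>i\<in>I. emeasure (\<nu> i) (B i))"
    if B: "\<And>i. i \<in> I \<Longrightarrow> B i \<in> sets (\<nu> i)" for B
    using emeasure_PiM_emb[OF prob subset_refl fin B] sets.sets_into_space[OF B]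
    by (simp add: P_def)
  have "\<forall>i\<in>I. \<exists>\<D>. countable \<D> \<and> \<D> \<subseteq> sets (\<nu> i) \<and> (\<forall>D\<in>\<D>. D \<subseteq> A i) \<and>
      (\<forall>\<omega>\<in>A i. \<forall>\<eta>>0. \<exists>D\<in>\<D>. \<omega> \<in> D \<and> (\<forall>\<omega>'\<in>D. d i (h i \<omega>) (h i \<omega>') < \<eta>))"
    using recurrence_model.fine_pieces[OF model] by blast
  from bchoice[OF this] obtain \<D> where "\<forall>i\<in>I. countable (\<D> i) \<and> \<D> i \<subseteq> sets (\<nu> i) \<and> (\<forall>D\<in>\<D> i. D \<subseteq> A i) \<and>
      (\<forall>\<omega>\<in>A i. \<forall>\<eta>>0. \<exists>D\<in>\<D> i. \<omega> \<in> D \<and> (\<forall>\<omega>'\<in>D. d i (h i \<omega>) (h i \<omega>') < \<eta>))" ..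
  then have \<D>: "\<And>i. i \<in> I \<Longrightarrow> countable (\<D> i)" "\<And>i. i \<in> I \<Longrightarrow> \<D> i \<subseteq> sets (\<nu> i)"
      "\<And>i D. i \<in> I \<Longrightarrow> D \<in> \<D> i \<Longrightarrow> D \<subseteq> A i"
      "\<And>i \<omega> \<eta>. i \<in> I \<Longrightarrow> \<omega> \<in> A i \<Longrightarrow> \<eta> > 0 \<Longrightarrow>
         \<exists>D\<in>\<D> i. \<omega> \<in> D \<and> (\<forall>\<omega>'\<in>D. d i (h i \<omega>) (h i \<omega>') < \<eta>)"
    by simp_all
  have good: "AE \<omega> in P. \<forall>D\<in>PiE I \<D>. \<omega> \<in> PiE I D \<longrightarrow> 0 < lower_density (return_set F \<omega> (PiE I D))"
  proof (rule AE_ball_countable')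
    fix D assume "D \<in> PiE I \<D>"
    then have "PiE I D \<in> sets P"
      using \<D>(2) fin unfolding P_def by (intro sets_PiM_I_finite) (auto simp: PiE_iff)
    then show "AE \<omega> in P. \<omega> \<in> PiE I D \<longrightarrow> 0 < lower_density (return_set F \<omega> (PiE I D))"
      by (intro P.AE_positive_lower_density_returns F inv)
  qed (use \<D>(1) fin in \<open>auto intro: countable_PiE\<close>)
  have often: "\<not> (AE \<omega> in P. \<omega> \<notin> PiE I A)"
  proof -
    have sA: "A i \<in> sets (\<nu> i)" if "i \<in> I" for i
      using recurrence_model.sets_A[OF model[OF that]] .
    have "emeasure P (PiE I A) = (\<Prod>i\<in>I. emeasure (\<nu> i) (A i))"
      using sA by (rule box)
    moreover have "emeasure (\<nu> i) (A i) \<noteq> 0" if "i \<in> I" for i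
      using recurrence_model.pos_A[OF model[OF that]] by (auto simp: measure_def)
    ultimately have "emeasure P (PiE I A) \<noteq> 0"
      using fin by simp
    moreover have "PiE I A \<in> sets P"
      unfolding P_def using fin sA by (intro sets_PiM_I_finite)
    ultimately show ?thesis
      using P.prob_eq_0[of "PiE I A"] by (simp add: P.emeasure_eq_measure)
  qed
  obtain \<omega> where \<omega>: "\<omega> \<in> PiE I A"
      "\<And>D. D \<in> PiE I \<D> \<Longrightarrow> \<omega> \<in> PiE I D \<Longrightarrow> 0 < lower_density (return_set F \<omega> (PiE I D))"
  proof (rule ccontr)
    assume none: "\<not> thesis"
    from good have "AE \<omega> in P. \<omega> \<notin> PiE I A"
    proof eventually_elim
      case (elim \<omega>)
      show ?case
      proof
        assume "\<omega> \<in> PiE I A"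
        from that[OF this] elim none show False by auto
      qed
    qed
    with often show False ..
  qed
  have Fn: "(F ^^ n) \<omega> = (\<lambda>i\<in>I. (\<sigma> ^^ n) (\<omega> i))" for n
  proof (induction n)
    case 0
    show ?case using \<omega>(1) by (auto simp: PiE_iff extensional_def fun_eq_iff)
  qed (auto simp: F_def compose_def)
  define y where "y = (\<lambda>i\<in>I. h i (\<omega> i))"
  have hQ: "h i (\<omega> i) \<in> Q i" if "i \<in> I" for i
    using recurrence_model.h_in[OF model[OF that]] \<omega>(1) that by (auto simp: PiE_iff)
  show thesis
  proof
    show "y \<in> (\<Pi>\<^sub>E i\<in>I. Q i)"
      using hQ by (auto simp: y_def)
    fix \<eta> :: real assume "0 < \<eta>"
    have "\<forall>i\<in>I. \<exists>D. D \<in> \<D> i \<and> \<omega> i \<in> D \<and> (\<forall>\<omega>'\<in>D. d i (h i (\<omega> i)) (h i \<omega>') < \<eta>)"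
      using \<D>(4)[OF _ _ \<open>0 < \<eta>\<close>] \<omega>(1) by (auto simp: PiE_iff Bex_def)
    from bchoice[OF this] obtain D0 where
      "\<forall>i\<in>I. D0 i \<in> \<D> i \<and> \<omega> i \<in> D0 i \<and> (\<forall>\<omega>'\<in>D0 i. d i (h i (\<omega> i)) (h i \<omega>') < \<eta>)" ..
    then have D0: "\<And>i. i \<in> I \<Longrightarrow> D0 i \<in> \<D> i" "\<And>i. i \<in> I \<Longrightarrow> \<omega> i \<in> D0 i"
        "\<And>i \<omega>'. i \<in> I \<Longrightarrow> \<omega>' \<in> D0 i \<Longrightarrow> d i (h i (\<omega> i)) (h i \<omega>') < \<eta>"
      by simp_all
    define D where "D = restrict D0 I"
    have PD: "PiE I D = PiE I D0"
      by (auto simp: D_def PiE_iff)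
    have "0 < lower_density (return_set F \<omega> (PiE I D))"
      using D0 \<omega>(1) by (intro \<omega>(2)) (auto simp: D_def PiE_iff)
    also have "\<dots> \<le> lower_density {n. \<forall>i\<in>I. d i (y i) ((T i ^^ n) (y i)) < \<eta>}"
    proof (rule lower_density_mono, rule subsetI, rule CollectI, rule ballI)
      fix n i assume n: "n \<in> return_set F \<omega> (PiE I D)" and i: "i \<in> I"
      then have *: "(\<sigma> ^^ n) (\<omega> i) \<in> D0 i"
        unfolding return_set_def PD Fn by (auto simp: PiE_iff)
      have "(T i ^^ n) (h i (\<omega> i)) = h i ((\<sigma> ^^ n) (\<omega> i))"
        using * \<D>(3)[OF i D0(1)[OF i]] \<omega>(1) i
        by (intro recurrence_model.equivariant[OF model[OF i]]) (auto simp: PiE_iff)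
      then show "d i (y i) ((T i ^^ n) (y i)) < \<eta>"
        using D0(3)[OF i *] i by (simp add: y_def)
    qed
    finally show "0 < lower_density {n. \<forall>i\<in>I. d i (y i) ((T i ^^ n) (y i)) < \<eta>}" .
  qed
qed

section \<open>Coding weak-star compact pieces of an orbit\<close>

lemma compact_imp_closed_fun:
  fixes K :: "('a \<Rightarrow> 'b::metric_space) set"
  assumes "compact K"
  shows "closed K"
proof -
  have "Hausdorff_space (euclidean :: ('a \<Rightarrow> 'b) topology)"
    unfolding euclidean_product_topology[symmetric] Hausdorff_space_product_topology
    by (intro disjI2 ballI Hausdorff_space_euclidean)
  then show ?thesis
    using compactin_imp_closedin[of euclidean K] assms by simp
qed

text \<open>
  \<open>E u\<close> is the point \<open>u\<close> seen as a functional, with pointwise convergence in the role of the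
  weak-star topology. The set \<open>W\<close> is the unit ball of the predual, \<open>Q\<close> a norm separable weak-star
  compact set, and \<open>P\<close> a countable set that is dense in \<open>Q\<close> but need not be contained in it.
\<close>

locale compact_evaluation = Metric_space M d for M :: "'x set" and d :: "'x \<Rightarrow> 'x \<Rightarrow> real" +
  fixes E :: "'x \<Rightarrow> 'y \<Rightarrow> 'k::euclidean_space" and W :: "'y set"
    and Q :: "'x set" and P :: "'x set" and T :: "'x \<Rightarrow> 'x"
  assumes norming: "u \<in> M \<Longrightarrow> v \<in> M \<Longrightarrow> d u v \<le> r \<longleftrightarrow> (\<forall>y\<in>W. norm (E u y - E v y) \<le> r)"
    and Q_sub: "Q \<subseteq> M" and P_sub: "P \<subseteq> M" and countable_P: "countable P"
    and dense: "u \<in> Q \<Longrightarrow> 0 < \<eta> \<Longrightarrow> \<exists>c\<in>P. d u c < \<eta>"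
    and compact_E: "compact (E ` Q)"
    and T_in: "u \<in> M \<Longrightarrow> T u \<in> M"
    and adjoint: "\<exists>S. \<forall>u\<in>M. \<forall>y. E ((T ^^ n) u) y = E u (S y)"
    and E_inj: "inj_on E M"
begin

lemma funpow_in: "u \<in> M \<Longrightarrow> (T ^^ n) u \<in> M"
  by (induction n) (auto intro: T_in)

text \<open>
  For every pair of points of \<open>P\<close> it suffices to take countably many \<open>y\<close> that nearly attain the
  supremum over \<open>W\<close>; by density the same functionals compute the distance from points of \<open>Q\<close> to
  points of \<open>P\<close>.
\<close>

lemma countable_norming:
  obtains V where "countable V"
    "\<And>u c r. u \<in> Q \<Longrightarrow> c \<in> P \<Longrightarrow> d u c \<le> r \<longleftrightarrow> (\<forall>y\<in>V. norm (E u y - E c y) \<le> r)"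
proof -
  have "\<exists>y\<in>W. q < norm (E u y - E c y)" if "u \<in> M" "c \<in> M" "q < d u c" for u c q
    using norming[OF that(1,2), of q] that(3) by (auto simp: not_le)
  then obtain g where g: "\<And>u c q. u \<in> M \<Longrightarrow> c \<in> M \<Longrightarrow> q < d u c \<Longrightarrow> g u c q \<in> W \<and> q < norm (E u (g u c q) - E c (g u c q))"
    by metis
  define V where "V = {g u c q |u c q. u \<in> P \<and> c \<in> P \<and> q \<in> \<rat> \<and> q < d u c}"
  have "V \<subseteq> (\<lambda>(u, c, q). g u c q) ` (P \<times> P \<times> \<rat>)"
    by (force simp: V_def)
  then have cV: "countable V"
    by (rule countable_subset) (auto intro: countable_P countable_rat)
  have VW: "V \<subseteq> W"
    using g P_sub by (auto simp: V_def)
  have "d u c \<le> r \<longleftrightarrow> (\<forall>y\<in>V. norm (E u y - E c y) \<le> r)" if u: "u \<in> Q" and c: "c \<in> P" for u c r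
  proof
    assume "d u c \<le> r"
    then show "\<forall>y\<in>V. norm (E u y - E c y) \<le> r"
      using norming[of u c r] u c Q_sub P_sub VW by blast
  next
    assume le: "\<forall>y\<in>V. norm (E u y - E c y) \<le> r"
    show "d u c \<le> r"
    proof (rule field_le_epsilon)
      fix e :: real assume "0 < e"
      obtain u' where u': "u' \<in> P" "d u u' < e / 4"
        using dense[OF u, of "e / 4"] \<open>0 < e\<close> by auto
      obtain q where q: "q \<in> \<rat>" "d u' c - e / 4 < q" "q < d u' c"
        using Rats_dense_in_real[of "d u' c - e / 4" "d u' c"] \<open>0 < e\<close> by auto
      define y where "y = g u' c q"
      have y: "y \<in> V" "q < norm (E u' y - E c y)"
        using g[of u' c q] u' c q P_sub by (auto simp: V_def y_def)
      have "norm (E u y - E u' y) \<le> d u u'"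
        using norming[of u u' "d u u'"] u u'(1) y(1) VW Q_sub P_sub by blast
      moreover have "norm (E u' y - E c y) \<le> norm (E u y - E c y) + norm (E u y - E u' y)"
        by (metis diff_add_cancel diff_diff_eq2 norm_minus_commute norm_triangle_sub add.commute)
      moreover have "norm (E u y - E c y) \<le> r" using le y(1) by blast
      moreover have "d u c \<le> d u u' + d u' c"
        using u u'(1) c Q_sub P_sub by (intro triangle) auto
      ultimately show "d u c \<le> r + e"
        using u'(2) q(2) y(2) \<open>0 < e\<close> by linarith
    qed
  qed
  with cV show thesis by (rule that)
qed

text \<open>
  The index \<open>Suc k\<close> of a code belongs to the \<open>k\<close>-th triple \<open>(y, b, q)\<close> with \<open>y \<in> V\<close>, \<open>b\<close> in the
  basis of the scalars and \<open>q\<close> rational, and its bit says on which side of \<open>q\<close> the coordinate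
  \<open>inner (E u y) b\<close> lies. So the bits form Dedekind cuts. Read with weak inequalities on both
  sides (the predicate \<open>C\<close>) they are closed conditions on \<open>E u\<close>. The code of a limit array is
  therefore satisfied by some point of \<open>Q\<close>, by compactness, and that point is unique
  because cuts determine the values on \<open>V\<close> and these determine the distances to \<open>P\<close>.
\<close>

theorem recurrence_model_exists:
  assumes x: "x \<in> M" and dens: "0 < upper_banach_density {n. (T ^^ n) x \<in> Q}"
  obtains \<nu> :: "(nat \<Rightarrow> nat \<Rightarrow> bool) measure" and A h
  where "recurrence_model \<nu> shift A h Q d T"
proof -
  obtain V where V: "countable V"
      "\<And>u c r. u \<in> Q \<Longrightarrow> c \<in> P \<Longrightarrow> d u c \<le> r \<longleftrightarrow> (\<forall>y\<in>V. norm (E u y - E c y) \<le> r)"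
    using countable_norming by blast
  have "Q \<noteq> {}"
  proof
    assume "Q = {}"
    with dens show False
      by (simp add: upper_banach_density_def zero_ereal_def[symmetric] Limsup_const)
  qed
  then obtain u0 c0 where "u0 \<in> Q" "c0 \<in> P"
    using dense[of _ 1] by fastforce
  then have "V \<noteq> {}"
    using V(2)[of u0 c0 "-1"] nonneg[of u0 c0] by auto
  define g where "g = from_nat_into (V \<times> (Basis :: 'k set) \<times> (\<rat> :: real set))"
  have range_g: "range g = V \<times> Basis \<times> \<rat>"
    unfolding g_def
  proof (rule range_from_nat_into)
    show "V \<times> (Basis :: 'k set) \<times> (\<rat> :: real set) \<noteq> {}"
      using \<open>V \<noteq> {}\<close> Rats_0 nonempty_Basis by blast
    show "countable (V \<times> (Basis :: 'k set) \<times> (\<rat> :: real set))"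
      by (intro countable_SIGMA V(1) countable_rat countable_finite finite_Basis)
  qed
  define C where "C k \<beta> \<phi> = (case g k of (y, b, q) \<Rightarrow> if \<beta> then inner (\<phi> y) b \<le> q else q \<le> inner (\<phi> y) b)"
    for k \<beta> and \<phi> :: "'y \<Rightarrow> 'k"
  have closed_C: "closed {\<phi>. C k \<beta> (\<lambda>y. \<phi> (S y))}" for k \<beta> S
    unfolding C_def by (cases "g k"; cases \<beta>) (auto intro!: closed_Collect_le continuous_intros)
  define w where "w n j = (case j of 0 \<Rightarrow> (T ^^ n) x \<in> Q | Suc k \<Rightarrow> C k True (E ((T ^^ n) x)))" for n j
  have C_w: "C k (w n (Suc k)) (E ((T ^^ n) x))" for n k
    by (cases "g k") (auto simp: w_def C_def)
  obtain \<nu> :: "(nat \<Rightarrow> nat \<Rightarrow> bool) measure" where "prob_space \<nu>" and sp: "space \<nu> = UNIV"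
    and st: "sets \<nu> = sigma_sets UNIV cylinders"
    and sh: "shift \<in> measurable \<nu> \<nu>" "distr \<nu> \<nu> shift = \<nu>" and pos: "0 < measure \<nu> {\<omega>. \<omega> 0 0}"
    and orbit: "AE \<omega> in \<nu>. \<forall>N. \<exists>n. \<forall>i<N. \<forall>j<N. \<omega> i j = w (n + i) j"
    by (rule furstenberg_correspondence[of w]) (use dens in \<open>simp add: w_def\<close>)
  interpret \<nu>: prob_space \<nu> by fact
  have coord: "{\<omega>. \<omega> i j} \<in> sets \<nu>" for i j
    using cylinder_coordinate by (auto simp: st)
  obtain Z where Z: "{\<omega>. \<not> (\<forall>N. \<exists>n. \<forall>i<N. \<forall>j<N. \<omega> i j = w (n + i) j)} \<subseteq> Z" "emeasure \<nu> Z = 0" "Z \<in> sets \<nu>"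
    using orbit by (auto elim!: AE_E simp: sp)
  define A where "A = {\<omega>. \<omega> 0 0} - Z"
  have sets_A: "A \<in> sets \<nu>"
    unfolding A_def using coord Z(3) by auto
  have A_orbit: "\<exists>n. \<forall>i<N. \<forall>j<N. \<omega> i j = w (n + i) j" if "\<omega> \<in> A" for \<omega> N
    using that Z(1) unfolding A_def by blast
  have pos_A: "0 < measure \<nu> A"
  proof -
    have "measure \<nu> A = measure \<nu> {\<omega>. \<omega> 0 0}"
      unfolding A_def using Z(2,3) coord by (intro measure_Diff_null_set) auto
    with pos show ?thesis by simp
  qed
  define decodes where "decodes \<beta> u \<longleftrightarrow> u \<in> Q \<and> (\<forall>k. C k (\<beta> (Suc k)) (E u))" for \<beta> :: "nat \<Rightarrow> bool" and u
  \<comment> \<open>Cuts determine the values \<open>E u y\<close> for \<open>y \<in> V\<close>, hence the distances to the dense set \<open>P\<close>.\<close>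
  have unique: "u = v" if u: "decodes \<beta> u" and v: "decodes \<beta> v" for \<beta> u v
  proof -
    have le: "inner (E v y) b \<le> inner (E u y) b"
      if dec: "decodes \<beta> u" "decodes \<beta> v" and y: "y \<in> V" and b: "b \<in> Basis" for u v y b
    proof (rule ccontr)
      assume "\<not> inner (E v y) b \<le> inner (E u y) b"
      then obtain q where q: "q \<in> \<rat>" "inner (E u y) b < q" "q < inner (E v y) b"
        using Rats_dense_in_real[of "inner (E u y) b" "inner (E v y) b"] by auto
      then have "(y, b, q) \<in> range g" using range_g y b by auto
      then obtain k where "g k = (y, b, q)" by auto
      moreover have "C k (\<beta> (Suc k)) (E u)" "C k (\<beta> (Suc k)) (E v)"
        using dec by (simp_all add: decodes_def)
      ultimately show False
        using q by (cases "\<beta> (Suc k)") (simp_all add: C_def)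
    qed
    have eq: "E u y = E v y" if "y \<in> V" for y
      by (rule euclidean_eqI, rule order_antisym) (auto intro: le[OF u v that] le[OF v u that])
    have uv: "u \<in> Q" "v \<in> Q" using u v by (auto simp: decodes_def)
    have "d u v \<le> 0"
    proof (rule field_le_epsilon)
      fix e :: real assume "0 < e"
      obtain c where c: "c \<in> P" "d u c < e / 2"
        using dense[OF uv(1), of "e / 2"] \<open>0 < e\<close> by auto
      have "d v c \<le> d u c"
        using V(2)[OF uv(1) c(1), of "d u c"] V(2)[OF uv(2) c(1), of "d u c"] eq by simp
      moreover have "d u v \<le> d u c + d v c"
        using uv c(1) Q_sub P_sub by (intro triangle') auto
      ultimately show "d u v \<le> 0 + e" using c(2) by linarith
    qed
    then show "u = v"
      using uv Q_sub nonneg[of u v] zero[of u v] by auto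
  qed
  \<comment> \<open>\<open>E ((T ^^ n) u)\<close> depends continuously on \<open>E u\<close>, so the conditions at time \<open>n\<close> are also closed
    conditions on \<open>E u\<close> and can be met together with those at time \<open>0\<close>: every finite number of
    them is met by some \<open>(T ^^ m) x\<close>, since \<open>\<omega>\<close> is in the orbit closure of the code of \<open>x\<close>.\<close>
  have joint: "\<exists>u. decodes (\<omega> 0) u \<and> decodes (\<omega> n) ((T ^^ n) u)" if \<omega>: "\<omega> \<in> A" "\<omega> n 0" for \<omega> n
  proof -
    obtain S where S: "\<And>u y. u \<in> M \<Longrightarrow> E ((T ^^ n) u) y = E u (S y)"
      using adjoint by blast
    define R where "R \<phi> = (\<lambda>y. \<phi> (S y))" for \<phi> :: "'y \<Rightarrow> 'k"
    have R_E: "R (E u) = E ((T ^^ n) u)" if "u \<in> M" for u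
      using S[OF that] by (auto simp: R_def)
    have cont_R: "continuous_on UNIV R"
      unfolding R_def by (intro continuous_on_coordinatewise_then_product continuous_on_product_coordinates)
    define F where "F k = {\<phi>. C k (\<omega> 0 (Suc k)) \<phi>} \<inter> {\<phi>. C k (\<omega> n (Suc k)) (R \<phi>)} \<inter> R -` (E ` Q)" for k
    have "E ` Q \<inter> (\<Inter>k. F k) \<noteq> {}"
    proof (rule compact_imp_fip_image[OF compact_E])
      show "closed (F k)" for k
        unfolding F_def R_def[abs_def] using closed_C[of k _ "\<lambda>y. y"] closed_C[of k _ S]
          compact_imp_closed_fun[OF compact_E] cont_R[unfolded R_def[abs_def]]
        by (intro closed_Int closed_vimage) auto
      fix I' :: "nat set" assume "finite I'"
      then obtain K where K: "\<And>k. k \<in> I' \<Longrightarrow> k \<le> K"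
        using finite_nat_set_iff_bounded_le by auto
      obtain m where m: "\<And>i j. i < n + K + 2 \<Longrightarrow> j < n + K + 2 \<Longrightarrow> \<omega> i j = w (m + i) j"
        using A_orbit[OF \<omega>(1)] by metis
      define u where "u = (T ^^ m) x"
      have Tu: "(T ^^ n) u = (T ^^ (m + n)) x"
        by (simp add: u_def funpow_add add.commute[of m n])
      have "u \<in> M" unfolding u_def by (rule funpow_in[OF x])
      have "u \<in> Q"
        using m[of 0 0] \<omega>(1) by (auto simp: A_def w_def u_def)
      moreover have "(T ^^ n) u \<in> Q"
        using m[of n 0] \<omega>(2) by (auto simp: w_def Tu)
      moreover have "C k (\<omega> 0 (Suc k)) (E u)" "C k (\<omega> n (Suc k)) (E ((T ^^ n) u))" if "k \<in> I'" for k
        using K[OF that] m[of 0 "Suc k"] m[of n "Suc k"] C_w[of k m] C_w[of k "m + n"]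
        by (auto simp: u_def[symmetric] Tu)
      ultimately have "E u \<in> E ` Q \<inter> (\<Inter>k\<in>I'. F k)"
        by (auto simp: F_def R_E[OF \<open>u \<in> M\<close>])
      then show "E ` Q \<inter> (\<Inter>k\<in>I'. F k) \<noteq> {}" by blast
    qed
    then obtain u where u: "u \<in> Q" "\<And>k. E u \<in> F k" by auto
    have "u \<in> M" using u(1) Q_sub by auto
    have "E ((T ^^ n) u) \<in> E ` Q"
      using u(2) by (auto simp: F_def R_E[OF \<open>u \<in> M\<close>])
    then have "(T ^^ n) u \<in> Q"
      using E_inj Q_sub funpow_in[OF \<open>u \<in> M\<close>] by (auto dest!: inj_onD)
    then show ?thesis
      using u by (intro exI[of _ u]) (auto simp: decodes_def F_def R_E[OF \<open>u \<in> M\<close>])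
  qed
  define h where "h \<omega> = (THE u. decodes (\<omega> 0) u)" for \<omega> :: "nat \<Rightarrow> nat \<Rightarrow> bool"
  have h_eq: "h \<omega> = u" if "decodes (\<omega> 0) u" for \<omega> u
    unfolding h_def using that by (intro the_equality) (auto intro: unique)
  have h_decodes: "decodes (\<omega> 0) (h \<omega>)" if "\<omega> \<in> A" for \<omega>
    using joint[OF that, of 0] that h_eq by (auto simp: A_def)
  have h_Q: "h \<omega> \<in> Q" if "\<omega> \<in> A" for \<omega>
    using h_decodes[OF that] by (simp add: decodes_def)
  have meas_E: "(\<lambda>\<omega>. if \<omega> \<in> A then E (h \<omega>) y else 0) \<in> borel_measurable \<nu>" if y: "y \<in> V" for y
  proof (subst borel_measurable_euclidean_space, intro ballI, unfold borel_measurable_iff_le, intro allI)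
    fix b :: 'k and s assume b: "b \<in> Basis"
    define K where "K = {k. \<exists>q. g k = (y, b, q) \<and> s < q}"
    have "inner (E (h \<omega>) y) b \<le> s \<longleftrightarrow> (\<forall>k\<in>K. \<omega> 0 (Suc k))" if \<omega>: "\<omega> \<in> A" for \<omega>
    proof
      assume le: "inner (E (h \<omega>) y) b \<le> s"
      show "\<forall>k\<in>K. \<omega> 0 (Suc k)"
      proof (rule ballI, rule ccontr)
        fix k assume "k \<in> K" and n: "\<not> \<omega> 0 (Suc k)"
        then obtain q where q: "g k = (y, b, q)" "s < q" by (auto simp: K_def)
        have "C k (\<omega> 0 (Suc k)) (E (h \<omega>))" using h_decodes[OF \<omega>] by (simp add: decodes_def)
        with n q le show False by (simp add: C_def)
      qed
    next
      assume all: "\<forall>k\<in>K. \<omega> 0 (Suc k)"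
      show "inner (E (h \<omega>) y) b \<le> s"
      proof (rule ccontr)
        assume "\<not> inner (E (h \<omega>) y) b \<le> s"
        then obtain q where q: "q \<in> \<rat>" "s < q" "q < inner (E (h \<omega>) y) b"
          using Rats_dense_in_real[of s "inner (E (h \<omega>) y) b"] by auto
        then have "(y, b, q) \<in> range g" using range_g y b by auto
        then obtain k where k: "g k = (y, b, q)" by (metis rangeE)
        with q all have "\<omega> 0 (Suc k)" by (auto simp: K_def)
        moreover have "C k (\<omega> 0 (Suc k)) (E (h \<omega>))" using h_decodes[OF \<omega>] by (simp add: decodes_def)
        ultimately show False using k q by (simp add: C_def)
      qed
    qed
    then have "{\<omega> \<in> space \<nu>. inner (if \<omega> \<in> A then E (h \<omega>) y else 0) b \<le> s}
        = (A \<inter> (\<Inter>k\<in>K. {\<omega>. \<omega> 0 (Suc k)})) \<union> (if 0 \<le> s then space \<nu> - A else {})"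
      by (auto simp: sp)
    also have "\<dots> \<in> sets \<nu>"
    proof (cases "K = {}")
      case True
      then show ?thesis using sets_A by auto
    next
      case False
      then have "(\<Inter>k\<in>K. {\<omega>. \<omega> 0 (Suc k)}) \<in> sets \<nu>"
        using coord by (intro sets.countable_INT') auto
      then show ?thesis using sets_A by auto
    qed
    finally show "{\<omega> \<in> space \<nu>. inner (if \<omega> \<in> A then E (h \<omega>) y else 0) b \<le> s} \<in> sets \<nu>" .
  qed
  have ball_sets: "{\<omega>\<in>A. d (h \<omega>) c \<le> r} \<in> sets \<nu>" if c: "c \<in> P" for c r
  proof -
    have "{\<omega>\<in>A. d (h \<omega>) c \<le> r}
        = A \<inter> (\<Inter>y\<in>V. {\<omega>\<in>space \<nu>. norm ((if \<omega> \<in> A then E (h \<omega>) y else 0) - E c y) \<le> r})"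
      using V(2)[OF h_Q c] \<open>V \<noteq> {}\<close> by (auto simp: sp)
    also have "\<dots> \<in> sets \<nu>"
    proof (intro sets.Int sets_A sets.countable_INT' V(1) \<open>V \<noteq> {}\<close> image_subsetI)
      fix y assume "y \<in> V"
      note [measurable] = meas_E[OF this]
      show "{\<omega>\<in>space \<nu>. norm ((if \<omega> \<in> A then E (h \<omega>) y else 0) - E c y) \<le> r} \<in> sets \<nu>"
        by measurable
    qed
    finally show ?thesis .
  qed
  have "recurrence_model \<nu> shift A h Q d T"
  proof
    fix \<omega> n assume \<omega>: "\<omega> \<in> A" "(shift ^^ n) \<omega> \<in> A"
    have sh_n: "(shift ^^ n) \<omega> 0 = \<omega> n" by (simp add: funpow_shift)
    then have "\<omega> n 0" using \<omega>(2) by (auto simp: A_def)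
    from joint[OF \<omega>(1) this] obtain u where "decodes (\<omega> 0) u" "decodes ((shift ^^ n) \<omega> 0) ((T ^^ n) u)"
      by (auto simp: sh_n)
    then show "(T ^^ n) (h \<omega>) = h ((shift ^^ n) \<omega>)"
      using h_eq by metis
  next
    let ?D = "(\<lambda>(c, k::nat). {\<omega>\<in>A. d (h \<omega>) c \<le> 1 / Suc k}) ` (P \<times> UNIV)"
    have "\<exists>D\<in>?D. \<omega> \<in> D \<and> (\<forall>\<omega>'\<in>D. d (h \<omega>) (h \<omega>') < \<eta>)" if \<omega>: "\<omega> \<in> A" and "0 < \<eta>" for \<omega> \<eta>
    proof -
      obtain k where k: "1 / Suc k < \<eta> / 2"
        using nat_approx_posE[of "\<eta> / 2"] \<open>0 < \<eta>\<close> by auto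
      obtain c where c: "c \<in> P" "d (h \<omega>) c < 1 / Suc k"
        using dense[OF h_Q[OF \<omega>], of "1 / Suc k"] by auto
      have "d (h \<omega>) (h \<omega>') < \<eta>" if "\<omega>' \<in> A" "d (h \<omega>') c \<le> 1 / Suc k" for \<omega>'
      proof -
        have "d (h \<omega>) (h \<omega>') \<le> d (h \<omega>) c + d (h \<omega>') c"
          using h_Q[OF \<omega>] h_Q[OF that(1)] c(1) Q_sub P_sub by (intro triangle') auto
        with c(2) that(2) k show ?thesis by linarith
      qed
      then show ?thesis
        using \<omega> c by (intro bexI[of _ "{\<omega>\<in>A. d (h \<omega>) c \<le> 1 / Suc k}"]) auto
    qed
    then show "\<exists>\<D>. countable \<D> \<and> \<D> \<subseteq> sets \<nu> \<and> (\<forall>D\<in>\<D>. D \<subseteq> A) \<and>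
      (\<forall>\<omega>\<in>A. \<forall>\<eta>>0. \<exists>D\<in>\<D>. \<omega> \<in> D \<and> (\<forall>\<omega>'\<in>D. d (h \<omega>) (h \<omega>') < \<eta>))"
      using ball_sets countable_P
      by (intro exI[of _ ?D] conjI) (auto intro!: countable_image countable_SIGMA simp del: of_nat_Suc)
  qed (use sh sets_A pos_A h_Q in auto)
  then show thesis by (rule that)
qed

end

section \<open>The Hahn-Banach theorem\<close>

context normed_vector_space
begin

lemma scalar_simps [simp]:
  "carrier (scalar_space :: ('k, 'k) normed_module) = UNIV"
  "(a \<oplus>\<^bsub>(scalar_space :: ('k, 'k) normed_module)\<^esub> b) = a + b"
  "(a \<otimes>\<^bsub>(scalar_space :: ('k, 'k) normed_module)\<^esub> b) = a * b"
  "\<one>\<^bsub>(scalar_space :: ('k, 'k) normed_module)\<^esub> = 1"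
  "\<zero>\<^bsub>(scalar_space :: ('k, 'k) normed_module)\<^esub> = 0"
  by (simp_all add: scalar_space_def)

lemma smult_in [simp, intro]: "x \<in> carrier X \<Longrightarrow> c \<odot> x \<in> carrier X"
  using smult_closed[of c x] by simp

lemma smult_add_left: "x \<in> carrier X \<Longrightarrow> (a + b) \<odot> x = a \<odot> x \<oplus> b \<odot> x"
  using smult_l_distr[of a b x] by simp

lemma smult_add_right: "x \<in> carrier X \<Longrightarrow> y \<in> carrier X \<Longrightarrow> c \<odot> (x \<oplus> y) = c \<odot> x \<oplus> c \<odot> y"
  using smult_r_distr[of c x y] by simp

lemma smult_mult: "x \<in> carrier X \<Longrightarrow> (a * b) \<odot> x = a \<odot> (b \<odot> x)"
  using smult_assoc1[of a b x] by simp

lemma smult_1 [simp]: "x \<in> carrier X \<Longrightarrow> 1 \<odot> x = x"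
  using smult_one[of x] by simp

lemma smult_0 [simp]: "x \<in> carrier X \<Longrightarrow> 0 \<odot> x = \<zero>"
  using smult_l_null[of x] by simp

lemma smult_zero [simp]: "c \<odot> \<zero> = \<zero>"
  using smult_r_null[of c] by simp

lemma smult_uminus: "x \<in> carrier X \<Longrightarrow> (- 1) \<odot> x = \<ominus> x"
  by (metis M.minus_equality smult_0 smult_1 smult_add_left smult_in add.left_inverse)

lemma minus_eq_smult: "x \<in> carrier X \<Longrightarrow> y \<in> carrier X \<Longrightarrow> x \<ominus> y = x \<oplus> (- 1) \<odot> y"
  by (simp add: smult_uminus a_minus_def)

text \<open>
  Homogeneity is stated as an inequality, from which equality follows, because inequalities are
  what infima of sublinear functionals inherit.
\<close>

definition sublinear :: "('x \<Rightarrow> real) \<Rightarrow> bool" where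
  "sublinear q \<longleftrightarrow>
     (\<forall>x\<in>carrier X. \<forall>y\<in>carrier X. q (x \<oplus> y) \<le> q x + q y) \<and>
     (\<forall>x\<in>carrier X. \<forall>t\<ge>0. q (of_real t \<odot> x) \<le> t * q x)"

lemma sublinearD:
  assumes "sublinear q" "x \<in> carrier X"
  shows "y \<in> carrier X \<Longrightarrow> q (x \<oplus> y) \<le> q x + q y"
    and "0 \<le> t \<Longrightarrow> q (of_real t \<odot> x) \<le> t * q x"
    and "q \<zero> = 0"
    and "0 \<le> t \<Longrightarrow> q (of_real t \<odot> x) = t * q x"
    and "- q (\<ominus> x) \<le> q x"
proof -
  have add: "q (x \<oplus> y) \<le> q x + q y" if "x \<in> carrier X" "y \<in> carrier X" for x y
    using assms(1) that unfolding sublinear_def by blast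
  have le: "q (of_real t \<odot> x) \<le> t * q x" if "0 \<le> t" "x \<in> carrier X" for t x
    using assms(1) that unfolding sublinear_def by blast
  show "q (x \<oplus> y) \<le> q x + q y" if "y \<in> carrier X"
    using add assms(2) that .
  show "q (of_real t \<odot> x) \<le> t * q x" if "0 \<le> t"
    using le that assms(2) .
  show z: "q \<zero> = 0"
    using add[of \<zero> \<zero>] le[of 0 \<zero>] by simp
  show "q (of_real t \<odot> x) = t * q x" if "0 \<le> t"
  proof (cases "t = 0")
    case True
    then show ?thesis using z assms(2) by simp
  next
    case False
    with that have "t > 0" by simp
    have "x = of_real (1 / t) \<odot> (of_real t \<odot> x)"
      using assms(2) \<open>t > 0\<close> by (simp flip: smult_mult of_real_mult)
    then have "q x \<le> 1 / t * q (of_real t \<odot> x)"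
      using le[of "1 / t" "of_real t \<odot> x"] assms(2) \<open>t > 0\<close> by simp
    then have "t * q x \<le> q (of_real t \<odot> x)"
      using \<open>t > 0\<close> by (simp add: field_simps)
    with le[OF that assms(2)] show ?thesis by simp
  qed
  show "- q (\<ominus> x) \<le> q x"
    using add[of x "\<ominus> x"] assms(2) z by (simp add: r_neg)
qed

text \<open>
  The infimum of \<open>q (x \<oplus> t y) - t q y\<close> over \<open>t \<ge> 0\<close> lies below \<open>q\<close> (take \<open>t = 0\<close>), is again
  sublinear, and witnesses how far \<open>q\<close> is from being additive in the direction \<open>y\<close> (take \<open>t = 1\<close>).
\<close>

lemma sublinear_lower:
  assumes q: "sublinear q" and y: "y \<in> carrier X"
  obtains q' where "sublinear q'" "\<And>x. x \<in> carrier X \<Longrightarrow> q' x \<le> q x"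
    "\<And>x. x \<in> carrier X \<Longrightarrow> q' x \<le> q (x \<oplus> y) - q y"
proof
  define S where "S x = (\<lambda>t. q (x \<oplus> of_real t \<odot> y) - t * q y) ` {0..}" for x
  define q' where "q' x = Inf (S x)" for x
  have bdd: "bdd_below (S x)" if x: "x \<in> carrier X" for x
  proof (rule bdd_belowI)
    fix r assume "r \<in> S x"
    then obtain t where t: "t \<ge> 0" "r = q (x \<oplus> of_real t \<odot> y) - t * q y" by (auto simp: S_def)
    have eq: "of_real t \<odot> y = (\<ominus> x) \<oplus> (x \<oplus> of_real t \<odot> y)"
      using x y by (simp add: a_assoc[symmetric] l_neg)
    have "t * q y = q (of_real t \<odot> y)"
      using sublinearD(4)[OF q y t(1)] by simp
    also have "\<dots> \<le> q (\<ominus> x) + q (x \<oplus> of_real t \<odot> y)"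
      by (subst eq, rule sublinearD(1)[OF q]) (use x y in auto)
    finally show "- q (\<ominus> x) \<le> r" by (simp add: t(2))
  qed
  have le: "q' x \<le> q (x \<oplus> of_real t \<odot> y) - t * q y" if "x \<in> carrier X" "0 \<le> t" for x t
    unfolding q'_def using that by (intro cInf_lower bdd) (auto simp: S_def)
  have ge: "b \<le> q' x" if "\<And>t. 0 \<le> t \<Longrightarrow> b \<le> q (x \<oplus> of_real t \<odot> y) - t * q y" for x b
    unfolding q'_def using that by (intro cInf_greatest) (auto simp: S_def)
  show "q' x \<le> q x" if "x \<in> carrier X" for x
    using le[OF that, of 0] that y by simp
  show "q' x \<le> q (x \<oplus> y) - q y" if "x \<in> carrier X" for x
    using le[OF that, of 1] y by simp
  show "sublinear q'"
    unfolding sublinear_def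
  proof (intro conjI ballI allI impI)
    fix x x' assume x: "x \<in> carrier X" "x' \<in> carrier X"
    have "q' (x \<oplus> x') - (q (x' \<oplus> of_real t \<odot> y) - t * q y) \<le> q' x" if t: "0 \<le> t" for t
    proof (rule ge)
      fix s :: real assume s: "0 \<le> s"
      have "(x \<oplus> x') \<oplus> of_real (s + t) \<odot> y = (x \<oplus> of_real s \<odot> y) \<oplus> (x' \<oplus> of_real t \<odot> y)"
        using x y by (simp add: smult_add_left a_ac)
      then have "q ((x \<oplus> x') \<oplus> of_real (s + t) \<odot> y) \<le> q (x \<oplus> of_real s \<odot> y) + q (x' \<oplus> of_real t \<odot> y)"
        using sublinearD(1)[OF q, of "x \<oplus> of_real s \<odot> y" "x' \<oplus> of_real t \<odot> y"] x y by simp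
      moreover have "q' (x \<oplus> x') \<le> q ((x \<oplus> x') \<oplus> of_real (s + t) \<odot> y) - (s + t) * q y"
        using x s t by (intro le) auto
      ultimately show "q' (x \<oplus> x') - (q (x' \<oplus> of_real t \<odot> y) - t * q y) \<le> q (x \<oplus> of_real s \<odot> y) - s * q y"
        by (simp add: algebra_simps)
    qed
    then have "q' (x \<oplus> x') - q' x \<le> q' x'"
      by (intro ge) (simp add: algebra_simps)
    then show "q' (x \<oplus> x') \<le> q' x + q' x'" by simp
  next
    fix x and a :: real assume x: "x \<in> carrier X" and "0 \<le> a"
    show "q' (of_real a \<odot> x) \<le> a * q' x"
    proof (cases "a = 0")
      case True
      then show ?thesis using le[of \<zero> 0] sublinearD(3)[OF q x] x y by simp
    next
      case False
      with \<open>0 \<le> a\<close> have a: "0 < a" by simp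
      have "q' (of_real a \<odot> x) / a \<le> q' x"
      proof (rule ge)
        fix t :: real assume t: "0 \<le> t"
        have "of_real a \<odot> x \<oplus> of_real (a * t) \<odot> y = of_real a \<odot> (x \<oplus> of_real t \<odot> y)"
          using x y by (simp add: smult_add_right smult_mult)
        then have "q (of_real a \<odot> x \<oplus> of_real (a * t) \<odot> y) \<le> a * q (x \<oplus> of_real t \<odot> y)"
          using sublinearD(2)[OF q, of "x \<oplus> of_real t \<odot> y" a] x y a by simp
        moreover have "q' (of_real a \<odot> x) \<le> q (of_real a \<odot> x \<oplus> of_real (a * t) \<odot> y) - (a * t) * q y"
          using x a t by (intro le) auto
        ultimately have "q' (of_real a \<odot> x) \<le> a * (q (x \<oplus> of_real t \<odot> y) - t * q y)"
          by (simp add: algebra_simps)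
        then show "q' (of_real a \<odot> x) / a \<le> q (x \<oplus> of_real t \<odot> y) - t * q y"
          using a by (simp add: field_simps)
      qed
      then show ?thesis using a by (simp add: field_simps)
    qed
  qed
qed

lemma sublinear_Inf_chain:
  assumes C: "C \<noteq> {}" "\<And>q. q \<in> C \<Longrightarrow> sublinear q" "\<And>q r. q \<in> C \<Longrightarrow> r \<in> C \<Longrightarrow> q \<le> r \<or> r \<le> q"
    and bound: "\<And>q x. q \<in> C \<Longrightarrow> x \<in> carrier X \<Longrightarrow> q x \<le> p x"
  shows "sublinear (\<lambda>x. INF q\<in>C. q x)"
    and "q \<in> C \<Longrightarrow> x \<in> carrier X \<Longrightarrow> (INF q\<in>C. q x) \<le> q x"
proof -
  have bdd: "bdd_below ((\<lambda>q. q x) ` C)" if x: "x \<in> carrier X" for x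
  proof (rule bdd_belowI2)
    fix q assume q: "q \<in> C"
    have "- p (\<ominus> x) \<le> - q (\<ominus> x)" using bound[OF q, of "\<ominus> x"] x by simp
    also have "\<dots> \<le> q x" by (rule sublinearD(5)[OF C(2)[OF q] x])
    finally show "- p (\<ominus> x) \<le> q x" .
  qed
  show le: "(INF q\<in>C. q x) \<le> q x" if "q \<in> C" "x \<in> carrier X" for q x
    using that by (intro cINF_lower bdd)
  show "sublinear (\<lambda>x. INF q\<in>C. q x)"
    unfolding sublinear_def
  proof (intro conjI ballI allI impI)
    fix x y assume x: "x \<in> carrier X" and y: "y \<in> carrier X"
    have *: "(INF q\<in>C. q (x \<oplus> y)) \<le> q x + r y" if qr: "q \<in> C" "r \<in> C" for q r
    proof -
      obtain s where s: "s \<in> C" "s \<le> q" "s \<le> r"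
        using C(3)[OF qr] qr by auto
      have "(INF q\<in>C. q (x \<oplus> y)) \<le> s (x \<oplus> y)" using s(1) x y by (intro le) auto
      also have "\<dots> \<le> s x + s y" by (rule sublinearD(1)[OF C(2)[OF s(1)] x y])
      also have "\<dots> \<le> q x + r y" using s(2,3) by (intro add_mono) (auto simp: le_fun_def)
      finally show ?thesis .
    qed
    have "(INF q\<in>C. q (x \<oplus> y)) - r y \<le> (INF q\<in>C. q x)" if "r \<in> C" for r
      using *[OF _ that] C(1) by (intro cINF_greatest) (auto simp: algebra_simps)
    then have "(INF q\<in>C. q (x \<oplus> y)) - (INF q\<in>C. q x) \<le> (INF r\<in>C. r y)"
      using C(1) by (intro cINF_greatest) (auto simp: algebra_simps)
    then show "(INF q\<in>C. q (x \<oplus> y)) \<le> (INF q\<in>C. q x) + (INF q\<in>C. q y)" by simp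
  next
    fix x and t :: real assume x: "x \<in> carrier X" and t: "0 \<le> t"
    have 1: "(INF q\<in>C. q (of_real t \<odot> x)) \<le> t * q x" if "q \<in> C" for q
    proof -
      have "(INF q\<in>C. q (of_real t \<odot> x)) \<le> q (of_real t \<odot> x)" using that x by (intro le) auto
      also have "\<dots> \<le> t * q x" by (rule sublinearD(2)[OF C(2)[OF that] x t])
      finally show ?thesis .
    qed
    show "(INF q\<in>C. q (of_real t \<odot> x)) \<le> t * (INF q\<in>C. q x)"
    proof (cases "t = 0")
      case True
      then show ?thesis using 1 C(1) by auto
    next
      case False
      with t have "0 < t" by simp
      have "(INF q\<in>C. q (of_real t \<odot> x)) / t \<le> (INF q\<in>C. q x)"
        using C(1) 1 \<open>0 < t\<close> by (intro cINF_greatest) (auto simp: field_simps)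
      then show ?thesis using \<open>0 < t\<close> by (simp add: field_simps)
    qed
  qed
qed

lemma minimal_sublinear_exists:
  assumes p: "sublinear p"
  obtains g where "sublinear g" "\<And>x. x \<in> carrier X \<Longrightarrow> g x \<le> p x"
    "\<And>q. sublinear q \<Longrightarrow> (\<And>x. x \<in> carrier X \<Longrightarrow> q x \<le> g x) \<Longrightarrow> (\<And>x. x \<in> carrier X \<Longrightarrow> q x = g x)"
proof -
  define A where "A = {q \<in> extensional (carrier X). sublinear q \<and> (\<forall>x\<in>carrier X. q x \<le> p x)}"
  have sub_restrict: "sublinear (restrict q (carrier X))" if "sublinear q" for q
    using that unfolding sublinear_def by auto
  have "\<exists>m\<in>A. \<forall>a\<in>A. m \<ge> a \<longrightarrow> a = m"
  proof (rule predicate_Zorn)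
    show "partial_order_on A (relation_of (\<ge>) A)"
      by (auto simp: partial_order_on_def preorder_on_def refl_on_def trans_def antisym_def relation_of_def)
    fix C assume "C \<in> Chains (relation_of (\<ge>) A)"
    then have C: "C \<subseteq> A" "\<And>q r. q \<in> C \<Longrightarrow> r \<in> C \<Longrightarrow> q \<le> r \<or> r \<le> q"
      by (auto simp: Chains_def relation_of_def)
    show "\<exists>u\<in>A. \<forall>a\<in>C. a \<ge> u"
    proof (cases "C = {}")
      case True
      have "restrict p (carrier X) \<in> A" using p sub_restrict by (auto simp: A_def)
      with True show ?thesis by auto
    next
      case False
      define u where "u = restrict (\<lambda>x. INF q\<in>C. q x) (carrier X)"
      have sC: "sublinear q" "x \<in> carrier X \<Longrightarrow> q x \<le> p x" if "q \<in> C" for q x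
        using C(1) that by (auto simp: A_def)
      have inf: "sublinear (\<lambda>x. INF q\<in>C. q x)"
          "\<And>q x. q \<in> C \<Longrightarrow> x \<in> carrier X \<Longrightarrow> (INF q\<in>C. q x) \<le> q x"
        using sublinear_Inf_chain[where C = C and p = p] False sC C(2) by auto
      have ule: "u x \<le> q x" if "q \<in> C" "x \<in> carrier X" for q x
        using inf(2)[OF that] that by (simp add: u_def)
      obtain q0 where "q0 \<in> C" using False by auto
      have "u x \<le> p x" if "x \<in> carrier X" for x
        using ule[OF \<open>q0 \<in> C\<close> that] sC(2)[OF \<open>q0 \<in> C\<close> that] by simp
      then have "u \<in> A"
        using sub_restrict[OF inf(1)] by (auto simp: A_def u_def)
      moreover have "u \<le> q" if "q \<in> C" for q
      proof (rule le_funI)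
        fix x
        have "q \<in> extensional (carrier X)" using C(1) that by (auto simp: A_def)
        then show "u x \<le> q x"
          using ule[OF that, of x] by (cases "x \<in> carrier X") (auto simp: u_def extensional_def)
      qed
      ultimately show ?thesis by auto
    qed
  qed
  then obtain g where g: "g \<in> A" "\<And>a. a \<in> A \<Longrightarrow> a \<le> g \<Longrightarrow> a = g" by auto
  show thesis
  proof
    show "sublinear g" "\<And>x. x \<in> carrier X \<Longrightarrow> g x \<le> p x" using g(1) by (auto simp: A_def)
    fix q x assume q: "sublinear q" "\<And>x. x \<in> carrier X \<Longrightarrow> q x \<le> g x" and x: "x \<in> carrier X"
    have "restrict q (carrier X) \<in> A"
      using sub_restrict[OF q(1)] q(2) g(1) by (force simp: A_def)
    moreover have "restrict q (carrier X) \<le> g"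
      using g(1) q(2) by (auto simp: le_fun_def A_def extensional_def)
    ultimately have "restrict q (carrier X) = g" by (rule g(2))
    then show "q x = g x" using x by (metis restrict_apply')
  qed
qed

text \<open>
  A minimal sublinear functional equals all its lowerings, which forces it to be additive and so
  real linear. To obtain \<open>p x0 \<le> g x0\<close>, \<open>p\<close> is first lowered in the direction \<open>x0\<close>: this makes the
  value at \<open>\<ominus> x0\<close> at most \<open>- p x0\<close> for everything below.
\<close>

lemma real_Hahn_Banach:
  assumes p: "sublinear p" and x0: "x0 \<in> carrier X"
  obtains g where "\<And>x y. x \<in> carrier X \<Longrightarrow> y \<in> carrier X \<Longrightarrow> g (x \<oplus> y) = g x + g y"
    "\<And>x t. x \<in> carrier X \<Longrightarrow> g (of_real t \<odot> x) = t * g x"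
    "\<And>x. x \<in> carrier X \<Longrightarrow> g x \<le> p x" "p x0 \<le> g x0"
proof -
  obtain p' where p': "sublinear p'" "\<And>x. x \<in> carrier X \<Longrightarrow> p' x \<le> p x"
    "\<And>x. x \<in> carrier X \<Longrightarrow> p' x \<le> p (x \<oplus> x0) - p x0"
    using sublinear_lower[OF p x0] by blast
  obtain g where g: "sublinear g" "\<And>x. x \<in> carrier X \<Longrightarrow> g x \<le> p' x"
    "\<And>q x. sublinear q \<Longrightarrow> (\<And>x. x \<in> carrier X \<Longrightarrow> q x \<le> g x) \<Longrightarrow> x \<in> carrier X \<Longrightarrow> q x = g x"
    using minimal_sublinear_exists[OF p'(1)] by blast
  have add: "g (x \<oplus> y) = g x + g y" if x: "x \<in> carrier X" and y: "y \<in> carrier X" for x y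
  proof (rule antisym)
    show "g (x \<oplus> y) \<le> g x + g y" using sublinearD(1)[OF g(1) x y] .
    obtain q where q: "sublinear q" "\<And>x. x \<in> carrier X \<Longrightarrow> q x \<le> g x"
      "\<And>x. x \<in> carrier X \<Longrightarrow> q x \<le> g (x \<oplus> y) - g y"
      using sublinear_lower[OF g(1) y] by blast
    have "q x = g x" using g(3)[OF q(1,2) x] .
    with q(3)[OF x] show "g x + g y \<le> g (x \<oplus> y)" by simp
  qed
  have neg: "g (\<ominus> x) = - g x" if "x \<in> carrier X" for x
    using add[of x "\<ominus> x"] that sublinearD(3)[OF g(1) that] by (simp add: r_neg)
  have hom: "g (of_real t \<odot> x) = t * g x" if x: "x \<in> carrier X" for x t
  proof (cases "0 \<le> t")
    case True
    then show ?thesis using sublinearD(4)[OF g(1) x] by simp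
  next
    case False
    have "of_real t \<odot> x = \<ominus> (of_real (- t) \<odot> x)"
      using x by (simp flip: smult_uminus smult_mult)
    with False neg[of "of_real (- t) \<odot> x"] sublinearD(4)[OF g(1) x, of "- t"] x show ?thesis by simp
  qed
  have "g (\<ominus> x0) \<le> p (\<ominus> x0 \<oplus> x0) - p x0"
    using g(2)[of "\<ominus> x0"] p'(3)[of "\<ominus> x0"] x0 by simp
  then have "p x0 \<le> g x0"
    using neg[OF x0] sublinearD(3)[OF p x0] x0 by (simp add: l_neg)
  then show thesis
    using that[of g] add hom g(2) p'(2) by (meson order_trans)
qed

end

text \<open>
  Multiplication by \<open>c\<close> multiplies norms by \<open>norm c\<close>, so by polarization it multiplies inner
  products by the square of that number.
\<close>

lemma inner_mult_right_scaled:
  fixes z w c :: "'k::{real_normed_field,euclidean_space}"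
  shows "inner (z * c) (w * c) = (norm c)\<^sup>2 * inner z w"
proof -
  have "(norm (z * c + w * c))\<^sup>2 = (norm c)\<^sup>2 * (norm (z + w))\<^sup>2"
    unfolding distrib_right[symmetric] norm_mult power_mult_distrib by (rule mult.commute)
  then show ?thesis
    unfolding dot_norm norm_mult power_mult_distrib by (simp add: algebra_simps)
qed

text \<open>
  The functional \<open>inner 1\<close> plays the part of the real part: the real values \<open>inner 1 (a * z)\<close>, for
  all scalars \<open>a\<close>, determine \<open>z\<close>.
\<close>

lemma inner_one_mult_eqD:
  fixes z w :: "'k::{real_normed_field,euclidean_space}"
  assumes "\<And>a. inner 1 (a * z) = inner 1 (a * w)"
  shows "z = w"
proof (rule ccontr)
  assume "z \<noteq> w"
  have "inner 1 (inverse (z - w) * (z - w)) = 0"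
    using assms by (simp add: inner_diff_right right_diff_distrib)
  with \<open>z \<noteq> w\<close> have "inner (1::'k) 1 = 0" by simp
  then show False by simp
qed

text \<open>
  A real linear \<open>g\<close> below \<open>p\<close> is the real part, that is \<open>inner 1 (f x)\<close>, of a unique scalar linear
  \<open>f\<close>: the condition \<open>inner 1 (a * f x) = g (a \<odot> x)\<close> for all \<open>a\<close> determines \<open>f x\<close>, and linearity
  follows from uniqueness. The scalar field being abstract, \<open>f x\<close> is found as follows. The
  functional \<open>a \<mapsto> g (a \<odot> x)\<close> is represented by a scalar \<open>c x\<close>, and the conjugate of \<open>c x\<close>,
  written \<open>(norm (c x))\<^sup>2 *\<^sub>R inverse (c x)\<close>, is \<open>f x\<close>. Choosing \<open>a = inverse (f x)\<close> gives
  \<open>norm (f x) \<le> p x\<close>, without loss of a constant.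
\<close>

lemma (in normed_vector_space) Hahn_Banach_seminorm:
  assumes sub: "\<And>x y. x \<in> carrier X \<Longrightarrow> y \<in> carrier X \<Longrightarrow> p (x \<oplus> y) \<le> p x + p y"
    and hom: "\<And>c x. x \<in> carrier X \<Longrightarrow> p (c \<odot> x) = norm c * p x"
    and x0: "x0 \<in> carrier X"
  obtains f :: "'x \<Rightarrow> 'k" where
    "\<And>x y. x \<in> carrier X \<Longrightarrow> y \<in> carrier X \<Longrightarrow> f (x \<oplus> y) = f x + f y"
    "\<And>c x. x \<in> carrier X \<Longrightarrow> f (c \<odot> x) = c * f x"
    "\<And>x. x \<in> carrier X \<Longrightarrow> norm (f x) \<le> p x" "norm (f x0) = p x0"
proof -
  have "sublinear p"
    unfolding sublinear_def using sub hom by auto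
  then obtain g where g: "\<And>x y. x \<in> carrier X \<Longrightarrow> y \<in> carrier X \<Longrightarrow> g (x \<oplus> y) = g x + g y"
    "\<And>x t. x \<in> carrier X \<Longrightarrow> g (of_real t \<odot> x) = t * g x"
    "\<And>x. x \<in> carrier X \<Longrightarrow> g x \<le> p x" "p x0 \<le> g x0"
    using real_Hahn_Banach[OF _ x0] by blast
  define c where "c x = (\<Sum>b\<in>Basis. g (b \<odot> x) *\<^sub>R b)" for x
  define f where "f x = (norm (c x))\<^sup>2 *\<^sub>R inverse (c x)" for x
  have inner_c: "inner (c x) a = g (a \<odot> x)" if x: "x \<in> carrier X" for x a
  proof -
    have lin: "linear (\<lambda>a. g (a \<odot> x))"
      using x by (intro linearI) (simp_all add: smult_add_left g(1) g(2)[symmetric] smult_mult scaleR_conv_of_real)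
    have "g (a \<odot> x) = g ((\<Sum>b\<in>Basis. inner a b *\<^sub>R b) \<odot> x)"
      by (simp add: euclidean_representation)
    also have "\<dots> = (\<Sum>b\<in>Basis. inner a b * g (b \<odot> x))"
      using linear_sum[OF lin, of "\<lambda>b. inner a b *\<^sub>R b" Basis] linear_scale[OF lin] by simp
    also have "\<dots> = inner (c x) a"
      by (simp add: c_def inner_commute[of _ a] inner_sum_right mult.commute)
    finally show ?thesis by simp
  qed
  have inner_f: "inner 1 (a * f x) = g (a \<odot> x)" if x: "x \<in> carrier X" for x a
  proof (cases "c x = 0")
    case True
    then show ?thesis using inner_c[OF x, of a] by (simp add: f_def)
  next
    case False
    have "inner 1 (a * f x) = (norm (c x))\<^sup>2 * inner 1 (a * inverse (c x))"
      by (simp add: f_def)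
    also have "\<dots> = inner (1 * c x) (a * inverse (c x) * c x)"
      by (rule inner_mult_right_scaled[symmetric])
    also have "\<dots> = inner (c x) a" using False by (simp add: mult.assoc)
    finally show ?thesis by (simp add: inner_c[OF x])
  qed
  have p_nonneg: "0 \<le> p x" if "x \<in> carrier X" for x
    using sub[of x "(- 1) \<odot> x"] hom[OF that, of "- 1"] hom[OF that, of 0] that
    by (simp add: smult_uminus r_neg)
  have bound: "norm (f x) \<le> p x" if x: "x \<in> carrier X" for x
  proof (cases "f x = 0")
    case True
    then show ?thesis using p_nonneg[OF x] by simp
  next
    case False
    then have "(1::real) = inner (1::'k) (inverse (f x) * f x)" by (simp add: dot_square_norm)
    also have "\<dots> \<le> p (inverse (f x) \<odot> x)"
      unfolding inner_f[OF x] using x by (intro g(3)) auto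
    also have "\<dots> = p x / norm (f x)"
      by (simp add: hom[OF x] norm_inverse divide_inverse mult.commute)
    finally show ?thesis using False by (simp add: field_simps)
  qed
  show thesis
  proof
    show "f (x \<oplus> y) = f x + f y" if xy: "x \<in> carrier X" "y \<in> carrier X" for x y
    proof (rule inner_one_mult_eqD)
      fix b
      show "inner 1 (b * f (x \<oplus> y)) = inner 1 (b * (f x + f y))"
        using xy by (simp add: inner_f distrib_left inner_add_right smult_add_right g(1))
    qed
    show "f (a \<odot> x) = a * f x" if x: "x \<in> carrier X" for a x
    proof (rule inner_one_mult_eqD)
      fix b
      show "inner 1 (b * f (a \<odot> x)) = inner 1 (b * (a * f x))"
        using x by (simp add: inner_f mult.assoc[symmetric] smult_mult)
    qed
    show "norm (f x) \<le> p x" if "x \<in> carrier X" for x using bound[OF that] .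
    have "p x0 \<le> inner 1 (f x0)"
      using inner_f[OF x0, of 1] g(4) x0 by simp
    also have "\<dots> \<le> norm (f x0)"
      using norm_cauchy_schwarz[of 1 "f x0"] by simp
    finally show "norm (f x0) = p x0" using bound[OF x0] by simp
  qed
qed

section \<open>Duality in normed spaces\<close>

text \<open>
  The Banach-Alaoglu theorem for a ball with centre \<open>\<phi>\<^sub>0\<close>, intersected with the annihilator of \<open>B\<close>:
  by Tychonoff's theorem the pointwise bounds describe a compact set, and linearity is a closed
  condition. Coordinates off the carrier are pinned to the default value.
\<close>

lemma compact_affine_ball:
  fixes Y :: "('k::{real_normed_field,euclidean_space}, 'y) normed_module"
  shows "compact {\<phi> \<in> extensional (carrier Y).
      (\<forall>y\<in>carrier Y. norm (\<phi> y - \<phi>\<^sub>0 y) \<le> \<epsilon> * vnorm Y y) \<and>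
      (\<forall>y\<in>carrier Y. \<forall>z\<in>carrier Y. \<phi> (y \<oplus>\<^bsub>Y\<^esub> z) = \<phi> y + \<phi> z) \<and>
      (\<forall>c. \<forall>y\<in>carrier Y. \<phi> (c \<odot>\<^bsub>Y\<^esub> y) = c * \<phi> y) \<and> (\<forall>y\<in>B. \<phi> y = 0)}"
    (is "compact ?K")
proof -
  define R where "R y = (if y \<in> carrier Y then cball (\<phi>\<^sub>0 y) (\<epsilon> * vnorm Y y) else {undefined})" for y
  have "compact (PiE UNIV R)"
  proof -
    have "compactin euclidean (R y)" for y by (simp add: R_def)
    then have "compactin (product_topology (\<lambda>_. euclidean) UNIV) (PiE UNIV R)"
      unfolding compactin_PiE by blast
    then show ?thesis by (simp add: euclidean_product_topology)
  qed
  moreover have "closed {\<phi> :: 'y \<Rightarrow> 'k.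
      (\<forall>y. y \<in> carrier Y \<longrightarrow> (\<forall>z. z \<in> carrier Y \<longrightarrow> \<phi> (y \<oplus>\<^bsub>Y\<^esub> z) = \<phi> y + \<phi> z)) \<and>
      (\<forall>c y. y \<in> carrier Y \<longrightarrow> \<phi> (c \<odot>\<^bsub>Y\<^esub> y) = c * \<phi> y) \<and> (\<forall>y. y \<in> B \<longrightarrow> \<phi> y = 0)}"
    by (intro closed_Collect_conj closed_Collect_all closed_Collect_imp open_Collect_const closed_Collect_eq
        continuous_on_product_coordinates continuous_intros)
  ultimately have "compact (PiE UNIV R \<inter> {\<phi>.
      (\<forall>y. y \<in> carrier Y \<longrightarrow> (\<forall>z. z \<in> carrier Y \<longrightarrow> \<phi> (y \<oplus>\<^bsub>Y\<^esub> z) = \<phi> y + \<phi> z)) \<and>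
      (\<forall>c y. y \<in> carrier Y \<longrightarrow> \<phi> (c \<odot>\<^bsub>Y\<^esub> y) = c * \<phi> y) \<and> (\<forall>y. y \<in> B \<longrightarrow> \<phi> y = 0)})"
    by (rule compact_Int_closed)
  also have "\<dots> = ?K"
    by (auto simp: R_def PiE_UNIV_domain Pi_iff extensional_def dist_norm norm_minus_commute split: if_splits)
  finally show ?thesis .
qed

context normed_vector_space
begin

lemma Metric_space_vdist: "Metric_space (carrier X) (vdist X)"
proof
  show "0 \<le> vdist X x y" for x y
    by (auto simp: vdist_def intro!: vnorm_nonneg)
  show "vdist X x y = vdist X y x" for x y
  proof (cases "x \<in> carrier X \<and> y \<in> carrier X")
    case True
    then have "y \<ominus> x = (- 1) \<odot> (x \<ominus> y)"
      by (simp add: smult_uminus a_minus_def minus_add a_comm)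
    with True show ?thesis by (simp add: vdist_def vnorm_smult)
  qed (auto simp: vdist_def)
  show "vdist X x y = 0 \<longleftrightarrow> x = y" if "x \<in> carrier X" "y \<in> carrier X" for x y
  proof -
    have "x = (x \<ominus> y) \<oplus> y" using that by (simp add: a_minus_def a_assoc l_neg)
    then have "x \<ominus> y = \<zero> \<longleftrightarrow> x = y"
      using that by (metis l_zero M.r_neg a_minus_def)
    then show ?thesis using that by (simp add: vdist_def vnorm_eq_0_iff)
  qed
  show "vdist X x z \<le> vdist X x y + vdist X y z"
    if "x \<in> carrier X" "y \<in> carrier X" "z \<in> carrier X" for x y z
  proof -
    have "(x \<ominus> y) \<oplus> (y \<ominus> z) = x \<oplus> ((\<ominus> y \<oplus> y) \<oplus> \<ominus> z)"
      using that unfolding a_minus_def by (simp only: a_assoc a_inv_closed add.m_closed)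
    also have "\<dots> = x \<ominus> z" using that by (simp add: l_neg a_minus_def)
    finally show ?thesis
      using vnorm_triangle[of "x \<ominus> y" "y \<ominus> z"] that by (simp add: vdist_def)
  qed
qed

lemma topspace_norm_topology: "topspace (norm_topology X) = carrier X"
  unfolding norm_topology_def by (rule Metric_space.topspace_mtopology[OF Metric_space_vdist])

lemma in_dual_iff:
  "f \<in> carrier (dual_space X) \<longleftrightarrow> f \<in> extensional (carrier X) \<and>
     (\<forall>x\<in>carrier X. \<forall>y\<in>carrier X. f (x \<oplus> y) = f x + f y) \<and>
     (\<forall>c. \<forall>x\<in>carrier X. f (c \<odot> x) = c * f x) \<and> (\<exists>C. \<forall>x\<in>carrier X. norm (f x) \<le> C * vnorm X x)"
  by (auto simp: dual_space_def bounded_linear_map_def scalar_space_def)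

lemma dual_simps:
  "x \<in> carrier X \<Longrightarrow> (f \<oplus>\<^bsub>dual_space X\<^esub> g) x = f x + g x"
  "x \<in> carrier X \<Longrightarrow> (c \<odot>\<^bsub>dual_space X\<^esub> f) x = c * f x"
  by (simp_all add: dual_space_def)

lemma dual_norm_le:
  assumes "\<And>x. x \<in> carrier X \<Longrightarrow> vnorm X x \<le> 1 \<Longrightarrow> norm (f x) \<le> r"
  shows "vnorm (dual_space X) f \<le> r"
proof -
  have "vnorm X \<zero> \<le> 1" using vnorm_eq_0_iff[of \<zero>] by simp
  then show ?thesis
    using assms by (auto simp: dual_space_def intro!: cSUP_least)
qed

lemma dual_bound:
  assumes f: "f \<in> carrier (dual_space X)" and x: "x \<in> carrier X"
  shows "norm (f x) \<le> vnorm (dual_space X) f * vnorm X x"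
proof (cases "vnorm X x = 0")
  case True
  have "f (0 \<odot> \<zero>) = 0 * f \<zero>" using f unfolding in_dual_iff by blast
  then show ?thesis using True vnorm_eq_0_iff[OF x] by simp
next
  case False
  with vnorm_nonneg[OF x] have pos: "0 < vnorm X x" by simp
  obtain C where C: "\<And>x. x \<in> carrier X \<Longrightarrow> norm (f x) \<le> C * vnorm X x"
    using f unfolding in_dual_iff by blast
  have bdd: "bdd_above ((\<lambda>y. norm (f y)) ` {y \<in> carrier X. vnorm X y \<le> 1})"
  proof (rule bdd_aboveI2)
    fix y assume y: "y \<in> {y \<in> carrier X. vnorm X y \<le> 1}"
    then have "norm (f y) \<le> C * vnorm X y" using C by auto
    also have "\<dots> \<le> \<bar>C\<bar> * 1" using y vnorm_nonneg[of y] by (intro mult_mono) auto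
    finally show "norm (f y) \<le> \<bar>C\<bar>" by simp
  qed
  define y where "y = of_real (inverse (vnorm X x)) \<odot> x"
  have y: "y \<in> carrier X" "vnorm X y = 1" using x pos by (auto simp: y_def vnorm_smult norm_inverse)
  have "f y = of_real (inverse (vnorm X x)) * f x"
    unfolding y_def using f x unfolding in_dual_iff by blast
  then have "norm (f x) = norm (f y) * vnorm X x"
    using pos by (simp add: norm_mult norm_inverse)
  moreover have "norm (f y) \<le> vnorm (dual_space X) f"
    unfolding dual_space_def using y by (auto intro!: cSUP_upper[OF _ bdd])
  ultimately show ?thesis using pos by (simp add: mult_right_mono)
qed

lemma functional_minus:
  assumes add: "\<And>x y. x \<in> carrier X \<Longrightarrow> y \<in> carrier X \<Longrightarrow> f (x \<oplus> y) = f x + f y"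
    and hom: "\<And>c x. x \<in> carrier X \<Longrightarrow> f (c \<odot> x) = c * f x"
    and "u \<in> carrier X" "v \<in> carrier X"
  shows "f (u \<ominus> v) = f u - f v"
  using assms(3,4) by (simp add: minus_eq_smult add hom)

lemma restrict_in_dual:
  assumes "\<And>x y. x \<in> carrier X \<Longrightarrow> y \<in> carrier X \<Longrightarrow> f (x \<oplus> y) = f x + f y"
    and "\<And>c x. x \<in> carrier X \<Longrightarrow> f (c \<odot> x) = c * f x"
    and "\<And>x. x \<in> carrier X \<Longrightarrow> norm (f x) \<le> C * vnorm X x"
  shows "restrict f (carrier X) \<in> carrier (dual_space X)"
  unfolding in_dual_iff using assms by (auto intro: exI[of _ C])

lemma norming_functional:
  assumes "u \<in> carrier X"
  obtains f where "f \<in> carrier (dual_space X)" "vnorm (dual_space X) f \<le> 1" "norm (f u) = vnorm X u"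
proof -
  obtain f where f: "\<And>x y. x \<in> carrier X \<Longrightarrow> y \<in> carrier X \<Longrightarrow> f (x \<oplus> y) = f x + f y"
    "\<And>c x. x \<in> carrier X \<Longrightarrow> f (c \<odot> x) = c * f x"
    "\<And>x. x \<in> carrier X \<Longrightarrow> norm (f x) \<le> vnorm X x" "norm (f u) = vnorm X u"
    using Hahn_Banach_seminorm[OF vnorm_triangle vnorm_smult assms] by blast
  have "norm (f x) \<le> 1" if "x \<in> carrier X" "vnorm X x \<le> 1" for x
    using f(3)[OF that(1)] that(2) by linarith
  with f assms show thesis
    by (intro that[of "restrict f (carrier X)"] restrict_in_dual[where C = 1] dual_norm_le) auto
qed

text \<open>
  Distance to the subspace \<open>G\<close> is a seminorm that vanishes on \<open>G\<close>; apply the Hahn-Banach theorem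
  to it.
\<close>

lemma separating_functional:
  assumes G: "G \<subseteq> carrier X" "G \<noteq> {}"
    "\<And>g h. g \<in> G \<Longrightarrow> h \<in> G \<Longrightarrow> g \<oplus> h \<in> G" "\<And>c g. g \<in> G \<Longrightarrow> c \<odot> g \<in> G"
    and u: "u \<in> carrier X" "0 < \<delta>" "\<And>g. g \<in> G \<Longrightarrow> \<delta> \<le> vnorm X (u \<ominus> g)"
  obtains f where "f \<in> carrier (dual_space X)" "\<And>g. g \<in> G \<Longrightarrow> f g = 0" "f u \<noteq> 0"
proof -
  define p where "p x = (INF g\<in>G. vnorm X (x \<ominus> g))" for x
  have le: "p x \<le> vnorm X (x \<ominus> g)" if "x \<in> carrier X" "g \<in> G" for x g
    unfolding p_def using that G(1) vnorm_nonneg by (intro cINF_lower bdd_belowI2[where m = 0]) auto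
  have ge: "b \<le> p x" if "\<And>g. g \<in> G \<Longrightarrow> b \<le> vnorm X (x \<ominus> g)" for x b
    unfolding p_def using that G(2) by (intro cINF_greatest)
  have zero: "\<zero> \<in> G" using G(4)[of _ 0] G(1,2) by (metis ex_in_conv smult_0 subsetD)
  have p_le: "p x \<le> vnorm X x" if "x \<in> carrier X" for x
    using le[OF that zero] that by (simp add: minus_eq_smult)
  have sub: "p (x \<oplus> y) \<le> p x + p y" if x: "x \<in> carrier X" and y: "y \<in> carrier X" for x y
  proof -
    have *: "p (x \<oplus> y) \<le> vnorm X (x \<ominus> g) + vnorm X (y \<ominus> h)" if g: "g \<in> G" and h: "h \<in> G" for g h
    proof -
      have c: "g \<in> carrier X" "h \<in> carrier X" using g h G(1) by auto
      have "p (x \<oplus> y) \<le> vnorm X ((x \<oplus> y) \<ominus> (g \<oplus> h))"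
        using x y g h by (intro le G(3)) auto
      also have "(x \<oplus> y) \<ominus> (g \<oplus> h) = (x \<ominus> g) \<oplus> (y \<ominus> h)"
        using x y c by (simp add: a_minus_def minus_add a_ac)
      also have "vnorm X \<dots> \<le> vnorm X (x \<ominus> g) + vnorm X (y \<ominus> h)"
        using x y c by (intro vnorm_triangle) auto
      finally show ?thesis .
    qed
    have "p (x \<oplus> y) - vnorm X (y \<ominus> h) \<le> p x" if "h \<in> G" for h
      using *[OF _ that] by (intro ge) (simp add: algebra_simps)
    then have "p (x \<oplus> y) - p x \<le> p y" by (intro ge) (simp add: algebra_simps)
    then show ?thesis by simp
  qed
  have hom_le: "p (c \<odot> x) \<le> norm c * p x" if x: "x \<in> carrier X" for c x
  proof (cases "c = 0")
    case True
    then show ?thesis using p_le[of \<zero>] vnorm_eq_0_iff[of \<zero>] x by simp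
  next
    case False
    have "p (c \<odot> x) / norm c \<le> p x"
    proof (rule ge)
      fix g assume g: "g \<in> G"
      then have gc: "g \<in> carrier X" using G(1) by auto
      have "c \<odot> x \<ominus> c \<odot> g = c \<odot> (x \<ominus> g)"
        using x gc by (simp add: minus_eq_smult smult_add_right smult_mult[symmetric] mult.commute)
      then have "p (c \<odot> x) \<le> norm c * vnorm X (x \<ominus> g)"
        using le[of "c \<odot> x" "c \<odot> g"] x g gc G(4) by (simp add: vnorm_smult)
      then show "p (c \<odot> x) / norm c \<le> vnorm X (x \<ominus> g)" using False by (simp add: field_simps)
    qed
    then show ?thesis using False by (simp add: field_simps)
  qed
  have hom: "p (c \<odot> x) = norm c * p x" if x: "x \<in> carrier X" for c x
  proof (cases "c = 0")
    case True
    have "0 \<le> p \<zero>" using G(1) vnorm_nonneg by (intro ge) auto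
    with hom_le[OF x, of 0] True x show ?thesis by simp
  next
    case False
    have "p x = p (inverse c \<odot> (c \<odot> x))" using False x by (simp flip: smult_mult)
    also have "\<dots> \<le> inverse (norm c) * p (c \<odot> x)"
      using hom_le[of "c \<odot> x" "inverse c"] x by (simp add: norm_inverse)
    finally have "norm c * p x \<le> p (c \<odot> x)" using False by (simp add: field_simps)
    with hom_le[OF x, of c] show ?thesis by simp
  qed
  obtain f where f: "\<And>x y. x \<in> carrier X \<Longrightarrow> y \<in> carrier X \<Longrightarrow> f (x \<oplus> y) = f x + f y"
    "\<And>c x. x \<in> carrier X \<Longrightarrow> f (c \<odot> x) = c * f x"
    "\<And>x. x \<in> carrier X \<Longrightarrow> norm (f x) \<le> p x" "norm (f u) = p u"
    using Hahn_Banach_seminorm[OF sub hom u(1)] by blast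
  have "p g \<le> 0" if "g \<in> G" for g
    using le[of g g] that G(1) vnorm_eq_0_iff[of \<zero>] by (auto simp: r_neg a_minus_def)
  then have "norm (f g) \<le> 0" if "g \<in> G" for g
    using f(3)[of g] that G(1) by (meson order_trans subsetD)
  moreover have "\<delta> \<le> p u" using u(3) by (rule ge)
  moreover have "norm (f x) \<le> 1 * vnorm X x" if "x \<in> carrier X" for x
    using f(3)[OF that] p_le[OF that] by simp
  ultimately show thesis
    using f(1,2,4) u(1,2) G(1)
    by (intro that[of "restrict f (carrier X)"] restrict_in_dual[where C = 1]) auto
qed

end

section \<open>Weak-star compact balls along an orbit\<close>

text \<open>
  What separable duals and reflexive spaces have in common. Through \<open>J\<close> the vectors of \<open>X\<close> are
  functionals on \<open>Y\<close>, and \<open>Z\<close> is the weak-star closed, norm separable part of \<open>X\<close>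
  cut out by the annihilator of \<open>B\<close>. For a separable dual, \<open>Z\<close> is all of \<open>X\<close> and \<open>B\<close> is empty;
  for a reflexive space, \<open>Z\<close> is the closed linear span of one orbit. Nonnegativity of the norm of
  \<open>Y\<close> is listed because \<open>Y\<close> is given as a bare record.
\<close>

locale weak_star_pairing = normed_vector_space X
  for X :: "('k::{real_normed_field,euclidean_space}, 'x) normed_module" (structure) +
  fixes Y :: "('k, 'y) normed_module" and J :: "'x \<Rightarrow> 'y \<Rightarrow> 'k" and T :: "'x \<Rightarrow> 'x"
    and Z :: "'x set" and B :: "'y set" and P :: "'x set"
  assumes J_extensional: "u \<in> carrier X \<Longrightarrow> J u \<in> extensional (carrier Y)"
    and J_diff: "u \<in> carrier X \<Longrightarrow> v \<in> carrier X \<Longrightarrow> y \<in> carrier Y \<Longrightarrow> J (u \<ominus> v) y = J u y - J v y"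
    and J_add: "u \<in> carrier X \<Longrightarrow> y \<in> carrier Y \<Longrightarrow> z \<in> carrier Y \<Longrightarrow> J u (y \<oplus>\<^bsub>Y\<^esub> z) = J u y + J u z"
    and J_smult: "u \<in> carrier X \<Longrightarrow> y \<in> carrier Y \<Longrightarrow> J u (c \<odot>\<^bsub>Y\<^esub> y) = c * J u y"
    and J_bound: "u \<in> carrier X \<Longrightarrow> y \<in> carrier Y \<Longrightarrow> norm (J u y) \<le> vnorm X u * vnorm Y y"
    and J_norming: "u \<in> carrier X \<Longrightarrow>
      (\<And>y. y \<in> carrier Y \<Longrightarrow> vnorm Y y \<le> 1 \<Longrightarrow> norm (J u y) \<le> r) \<Longrightarrow> vnorm X u \<le> r"
    and J_onto: "\<phi> \<in> carrier (dual_space Y) \<Longrightarrow> (\<And>y. y \<in> B \<Longrightarrow> \<phi> y = 0) \<Longrightarrow> \<exists>u\<in>Z. J u = \<phi>"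
    and B_annihilates: "u \<in> Z \<Longrightarrow> y \<in> B \<Longrightarrow> J u y = 0"
    and Z_sub: "Z \<subseteq> carrier X"
    and P_sub: "P \<subseteq> carrier X" and P_countable: "countable P"
    and P_dense: "u \<in> Z \<Longrightarrow> 0 < \<eta> \<Longrightarrow> \<exists>c\<in>P. vdist X u c < \<eta>"
    and T_in: "u \<in> carrier X \<Longrightarrow> T u \<in> carrier X"
    and J_adjoint: "\<exists>S. \<forall>u\<in>carrier X. \<forall>y\<in>carrier Y. J ((T ^^ n) u) y = J u (S y)"
    and Y_norm_nonneg: "y \<in> carrier Y \<Longrightarrow> 0 \<le> vnorm Y y"
begin

sublocale Metric_space "carrier X" "vdist X"
  by (rule Metric_space_vdist)

lemma vdist_le_iff:
  assumes u: "u \<in> carrier X" and v: "v \<in> carrier X"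
  shows "vdist X u v \<le> r \<longleftrightarrow> (\<forall>y\<in>{y \<in> carrier Y. vnorm Y y \<le> 1}. norm (J u y - J v y) \<le> r)"
proof
  assume le: "vdist X u v \<le> r"
  show "\<forall>y\<in>{y \<in> carrier Y. vnorm Y y \<le> 1}. norm (J u y - J v y) \<le> r"
  proof
    fix y assume y: "y \<in> {y \<in> carrier Y. vnorm Y y \<le> 1}"
    have "norm (J u y - J v y) \<le> vnorm X (u \<ominus> v) * vnorm Y y"
      using J_bound[of "u \<ominus> v" y] J_diff[OF u v] u v y by simp
    also have "\<dots> \<le> vnorm X (u \<ominus> v) * 1"
      using y vnorm_nonneg[of "u \<ominus> v"] u v by (intro mult_left_mono) auto
    finally show "norm (J u y - J v y) \<le> r" using le u v by (simp add: vdist_def)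
  qed
next
  assume "\<forall>y\<in>{y \<in> carrier Y. vnorm Y y \<le> 1}. norm (J u y - J v y) \<le> r"
  then have "vnorm X (u \<ominus> v) \<le> r"
    using u v by (intro J_norming) (auto simp: J_diff)
  then show "vdist X u v \<le> r" using u v by (simp add: vdist_def)
qed

lemma J_inj: "inj_on J (carrier X)"
proof (rule inj_onI)
  fix u v assume "u \<in> carrier X" "v \<in> carrier X" "J u = J v"
  then have "vdist X u v \<le> 0" by (subst vdist_le_iff) auto
  then show "u = v" using \<open>u \<in> carrier X\<close> \<open>v \<in> carrier X\<close> nonneg[of u v] zero[of u v] by simp
qed

text \<open>
  The image consists of all linear functionals \<open>\<phi>\<close> that vanish on \<open>B\<close> and satisfy
  \<open>norm (\<phi> y - J x y) \<le> \<epsilon> * vnorm Y y\<close>: such a \<open>\<phi>\<close> is bounded, hence of the form \<open>J u\<close>, and the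
  norming property of \<open>Y\<close> turns the pointwise estimate into \<open>vdist X u x \<le> \<epsilon>\<close>.
\<close>

lemma compact_ball_image:
  assumes x: "x \<in> carrier X" and \<epsilon>: "0 \<le> \<epsilon>"
  shows "compact (J ` (Z \<inter> mcball x \<epsilon>))"
proof -
  let ?K = "{\<phi> \<in> extensional (carrier Y).
      (\<forall>y\<in>carrier Y. norm (\<phi> y - J x y) \<le> \<epsilon> * vnorm Y y) \<and>
      (\<forall>y\<in>carrier Y. \<forall>z\<in>carrier Y. \<phi> (y \<oplus>\<^bsub>Y\<^esub> z) = \<phi> y + \<phi> z) \<and>
      (\<forall>c. \<forall>y\<in>carrier Y. \<phi> (c \<odot>\<^bsub>Y\<^esub> y) = c * \<phi> y) \<and> (\<forall>y\<in>B. \<phi> y = 0)}"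
  have "J ` (Z \<inter> mcball x \<epsilon>) = ?K"
  proof (intro subset_antisym subsetI)
    fix \<phi> assume "\<phi> \<in> J ` (Z \<inter> mcball x \<epsilon>)"
    then obtain u where u: "\<phi> = J u" "u \<in> Z" "u \<in> carrier X" "vdist X x u \<le> \<epsilon>" by auto
    have "norm (J u y - J x y) \<le> \<epsilon> * vnorm Y y" if y: "y \<in> carrier Y" for y
    proof -
      have "norm (J u y - J x y) \<le> vnorm X (u \<ominus> x) * vnorm Y y"
        using J_bound[of "u \<ominus> x" y] J_diff[OF u(3) x] u(3) x y by simp
      also have "vnorm X (u \<ominus> x) = vdist X x u"
        using u(3) x commute[of x u] by (simp add: vdist_def)
      also have "\<dots> * vnorm Y y \<le> \<epsilon> * vnorm Y y"
        using u(4) Y_norm_nonneg[OF y] by (rule mult_right_mono)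
      finally show ?thesis .
    qed
    then show "\<phi> \<in> ?K"
      using u J_extensional J_add J_smult B_annihilates by auto
  next
    fix \<phi> assume \<phi>: "\<phi> \<in> ?K"
    have "norm (\<phi> y) \<le> (\<epsilon> + vnorm X x) * vnorm Y y" if y: "y \<in> carrier Y" for y
    proof -
      have "norm (\<phi> y) \<le> norm (J x y) + norm (\<phi> y - J x y)"
        by (rule norm_triangle_sub)
      also have "\<dots> \<le> vnorm X x * vnorm Y y + \<epsilon> * vnorm Y y"
        using \<phi> y J_bound[OF x y] by (intro add_mono) auto
      finally show ?thesis by (simp add: algebra_simps)
    qed
    then have "\<phi> \<in> carrier (dual_space Y)"
      using \<phi> by (auto simp: dual_space_def bounded_linear_map_def scalar_space_def)
    then obtain u where u: "u \<in> Z" "J u = \<phi>"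
      using J_onto[of \<phi>] \<phi> by auto
    have uX: "u \<in> carrier X" using u(1) Z_sub by auto
    have "norm (J u y - J x y) \<le> \<epsilon>" if "y \<in> carrier Y" "vnorm Y y \<le> 1" for y
    proof -
      have "norm (J u y - J x y) \<le> \<epsilon> * vnorm Y y" using \<phi> u(2) that(1) by auto
      also have "\<dots> \<le> \<epsilon> * 1" using that(2) \<epsilon> by (rule mult_left_mono)
      finally show ?thesis by simp
    qed
    then have "vdist X u x \<le> \<epsilon>" using vdist_le_iff[OF uX x] by auto
    then show "\<phi> \<in> J ` (Z \<inter> mcball x \<epsilon>)"
      using u uX x commute[of u x] by auto
  qed
  then show ?thesis by (simp add: compact_affine_ball)
qed

lemma model_near_point:
  assumes x: "\<And>n. (T ^^ n) x \<in> Z" and rec: "x \<in> RRec X T" and \<epsilon>: "0 < \<epsilon>"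
  obtains \<nu> :: "(nat \<Rightarrow> nat \<Rightarrow> bool) measure" and A h
  where "recurrence_model \<nu> shift A h {u \<in> carrier X. vdist X x u \<le> \<epsilon>} (vdist X) T"
proof -
  have xX: "x \<in> carrier X" using x[of 0] Z_sub by auto
  have adj: "\<exists>S. \<forall>u\<in>carrier X. \<forall>y. J ((T ^^ n) u) y = J u (S y)" for n
  proof -
    obtain S where S: "\<And>u y. u \<in> carrier X \<Longrightarrow> y \<in> carrier Y \<Longrightarrow> J ((T ^^ n) u) y = J u (S y)"
      using J_adjoint[of n] by blast
    have "(T ^^ n) u \<in> carrier X" if "u \<in> carrier X" for u
      using that by (induction n) (auto intro: T_in)
    \<comment> \<open>Functionals are extensional, so off the carrier both sides take the default value and
      the index can be left alone there.\<close>
    then have "J ((T ^^ n) u) y = J u (if y \<in> carrier Y then S y else y)" if "u \<in> carrier X" for u y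
      using S J_extensional that by (auto simp: extensional_def)
    then show ?thesis by (intro exI[of _ "\<lambda>y. if y \<in> carrier Y then S y else y"] ballI allI)
  qed
  interpret ev: compact_evaluation "carrier X" "vdist X" J "{y \<in> carrier Y. vnorm Y y \<le> 1}"
      "Z \<inter> mcball x \<epsilon>" P T
  proof
    show "vdist X u v \<le> r \<longleftrightarrow> (\<forall>y\<in>{y \<in> carrier Y. vnorm Y y \<le> 1}. norm (J u y - J v y) \<le> r)"
      if "u \<in> carrier X" "v \<in> carrier X" for u v r
      using that by (rule vdist_le_iff)
    show "Z \<inter> mcball x \<epsilon> \<subseteq> carrier X" using Z_sub by auto
    show "\<exists>c\<in>P. vdist X u c < \<eta>" if "u \<in> Z \<inter> mcball x \<epsilon>" "0 < \<eta>" for u \<eta>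
      using that by (intro P_dense) auto
    show "compact (J ` (Z \<inter> mcball x \<epsilon>))"
      using xX \<epsilon> by (intro compact_ball_image) auto
  qed (rule P_sub P_countable T_in adj J_inj; assumption)+
  have "x \<in> norm_topology X interior_of (mcball x \<epsilon>)"
    unfolding norm_topology_def in_interior_of_mcball using xX \<epsilon> by auto
  then have "0 < upper_banach_density (return_set T x (mcball x \<epsilon>))"
    using rec mcball_subset_mspace[of x \<epsilon>] unfolding RRec_def recurrent_points_def by blast
  also have "return_set T x (mcball x \<epsilon>) = {n. (T ^^ n) x \<in> Z \<inter> mcball x \<epsilon>}"
    using x by (auto simp: return_set_def)
  finally obtain \<nu> :: "(nat \<Rightarrow> nat \<Rightarrow> bool) measure" and A h
    where "recurrence_model \<nu> shift A h (Z \<inter> mcball x \<epsilon>) (vdist X) T"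
    using ev.recurrence_model_exists[OF xX] by blast
  then have "recurrence_model \<nu> shift A h {u \<in> carrier X. vdist X x u \<le> \<epsilon>} (vdist X) T"
    by (auto simp: recurrence_model_def recurrence_model_axioms_def)
  then show thesis by (rule that)
qed

end

lemma linear_map_simps:
  assumes "bounded_linear_map X X T"
  shows "x \<in> carrier X \<Longrightarrow> T x \<in> carrier X"
    and "x \<in> carrier X \<Longrightarrow> y \<in> carrier X \<Longrightarrow> T (x \<oplus>\<^bsub>X\<^esub> y) = T x \<oplus>\<^bsub>X\<^esub> T y"
    and "x \<in> carrier X \<Longrightarrow> T (c \<odot>\<^bsub>X\<^esub> x) = c \<odot>\<^bsub>X\<^esub> T x"
    and "x \<in> carrier X \<Longrightarrow> (T ^^ n) x \<in> carrier X"
proof -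
  show *: "T x \<in> carrier X" if "x \<in> carrier X" for x
    using assms that by (auto simp: bounded_linear_map_def)
  show "(T ^^ n) x \<in> carrier X" if "x \<in> carrier X"
    using that by (induction n) (auto intro: *)
qed (use assms in \<open>auto simp: bounded_linear_map_def\<close>)

lemma separable_dual_pairing:
  assumes "adjoint_on_separable_dual Y S J X T"
  obtains P where "weak_star_pairing X Y J T (carrier X) {} P"
proof -
  have Y: "banach_space Y" and S: "bounded_linear_map Y Y S" and X: "banach_space X"
    and sep: "separable_space (norm_topology X)" and T: "bounded_linear_map X X T"
    and iso: "isometric_isomorphism X (dual_space Y) J"
    and adj: "\<And>x. x \<in> carrier X \<Longrightarrow> J (T x) = adjoint_operator Y S (J x)"
    using assms by (auto simp: adjoint_on_separable_dual_def)
  interpret X: normed_vector_space X using X by (rule banach_space.axioms)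
  interpret Y: normed_vector_space Y using Y by (rule banach_space.axioms)
  have J: "J u \<in> carrier (dual_space Y)" "vnorm (dual_space Y) (J u) = vnorm X u" if "u \<in> carrier X" for u
    using iso that by (auto simp: isometric_isomorphism_def bounded_linear_map_def)
  have J_lin: "J (u \<oplus>\<^bsub>X\<^esub> v) = J u \<oplus>\<^bsub>dual_space Y\<^esub> J v" "J (c \<odot>\<^bsub>X\<^esub> u) = c \<odot>\<^bsub>dual_space Y\<^esub> J u"
    if "u \<in> carrier X" "v \<in> carrier X" for u v c
    using iso that by (auto simp: isometric_isomorphism_def bounded_linear_map_def)
  obtain P where P: "countable P" "P \<subseteq> carrier X" "norm_topology X closure_of P = carrier X"
    using sep by (auto simp: separable_space_def X.topspace_norm_topology)
  have P_dense: "\<exists>c\<in>P. vdist X u c < \<eta>" if "u \<in> carrier X" "0 < \<eta>" for u \<eta>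
  proof -
    interpret Metric_space "carrier X" "vdist X" by (rule X.Metric_space_vdist)
    from that P(3) show ?thesis
      by (fastforce simp: norm_topology_def metric_closure_of)
  qed
  have pow: "J ((T ^^ n) u) y = J u ((S ^^ n) y)" if "u \<in> carrier X" "y \<in> carrier Y" for n u y
    using that(2)
  proof (induction n arbitrary: y)
    case (Suc n)
    have "J ((T ^^ Suc n) u) y = J ((T ^^ n) u) (S y)"
      using adj[of "(T ^^ n) u"] linear_map_simps(4)[OF T] that(1) Suc.prems
      by (simp add: adjoint_operator_def)
    also have "\<dots> = J u ((S ^^ Suc n) y)"
      using Suc.IH[of "S y"] linear_map_simps(1)[OF S] Suc.prems by (simp add: funpow_swap1)
    finally show ?case .
  qed simp
  have "weak_star_pairing X Y J T (carrier X) {} P"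
  proof
    fix u v y z c assume u: "u \<in> carrier X"
    show "J u \<in> extensional (carrier Y)" using J(1)[OF u] by (simp add: Y.in_dual_iff)
    show "J (u \<ominus>\<^bsub>X\<^esub> v) y = J u y - J v y" if "v \<in> carrier X" "y \<in> carrier Y"
      using u that by (simp add: X.minus_eq_smult J_lin Y.dual_simps)
    show "J u (y \<oplus>\<^bsub>Y\<^esub> z) = J u y + J u z" if "y \<in> carrier Y" "z \<in> carrier Y"
      using J(1)[OF u] that by (simp add: Y.in_dual_iff)
    show "J u (c \<odot>\<^bsub>Y\<^esub> y) = c * J u y" if "y \<in> carrier Y"
      using J(1)[OF u] that by (simp add: Y.in_dual_iff)
    show "norm (J u y) \<le> vnorm X u * vnorm Y y" if "y \<in> carrier Y"
      using Y.dual_bound[OF J(1)[OF u] that] J(2)[OF u] by simp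
    show "T u \<in> carrier X" using linear_map_simps(1)[OF T u] .
  next
    show "vnorm X u \<le> r" if "u \<in> carrier X"
      "\<And>y. y \<in> carrier Y \<Longrightarrow> vnorm Y y \<le> 1 \<Longrightarrow> norm (J u y) \<le> r" for u r
      using Y.dual_norm_le[of "J u" r] that J(2) by simp
    show "\<exists>u\<in>carrier X. J u = \<phi>" if "\<phi> \<in> carrier (dual_space Y)" for \<phi>
      using iso that unfolding isometric_isomorphism_def bij_betw_def by (metis image_iff)
    show "\<exists>S. \<forall>u\<in>carrier X. \<forall>y\<in>carrier Y. J ((T ^^ n) u) y = J u (S y)" for n
      using pow by blast
    show "0 \<le> vnorm Y y" if "y \<in> carrier Y" for y
      using Y.vnorm_nonneg[OF that] .
  qed (use P P_dense in auto)
  then show thesis by (rule that)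
qed

section \<open>Reflexive spaces\<close>

context normed_vector_space
begin

text \<open>
  The value at \<open>x\<close> of the polynomial in \<open>T\<close> with coefficient list \<open>cs\<close>, constant term first. The
  recursion of Horner's scheme lets facts about the linear span of the orbit be proved by
  induction on lists, without finite sums over the carrier.
\<close>

primrec horner :: "('x \<Rightarrow> 'x) \<Rightarrow> 'x \<Rightarrow> 'k list \<Rightarrow> 'x" where
  "horner T x [] = \<zero>"
| "horner T x (c # cs) = c \<odot> x \<oplus> T (horner T x cs)"

context
  fixes T :: "'x \<Rightarrow> 'x" and x :: 'x
  assumes T: "bounded_linear_map X X T" and x: "x \<in> carrier X"
begin

lemmas T_simps = linear_map_simps(1-3)[OF T]

lemma T_zero: "T \<zero> = \<zero>"
  using T_simps(1)[of \<zero>] T_simps(3)[of \<zero> 0] by simp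

lemma horner_in: "horner T x cs \<in> carrier X"
  by (induction cs) (auto simp: x T_simps)

lemma horner_add: "\<exists>es. horner T x cs \<oplus> horner T x ds = horner T x es"
proof (induction cs arbitrary: ds)
  case Nil
  show ?case by (intro exI[of _ ds]) (simp add: horner_in)
next
  case (Cons c cs)
  show ?case
  proof (cases ds)
    case Nil
    then show ?thesis by (intro exI[of _ "c # cs"]) (simp add: horner_in x T_simps)
  next
    case (Cons d ds')
    obtain es where es: "horner T x cs \<oplus> horner T x ds' = horner T x es" using Cons.IH by blast
    have "horner T x (c # cs) \<oplus> horner T x ds
        = (c \<odot> x \<oplus> d \<odot> x) \<oplus> (T (horner T x cs) \<oplus> T (horner T x ds'))"
      using x by (simp add: Cons a_ac T_simps horner_in)
    also have "\<dots> = horner T x ((c + d) # es)"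
      using x by (simp add: smult_add_left flip: es T_simps(2)[OF horner_in horner_in])
    finally show ?thesis by blast
  qed
qed

lemma horner_smult: "a \<odot> horner T x cs = horner T x (map ((*) a) cs)"
  by (induction cs) (simp_all add: x horner_in T_simps smult_add_right smult_mult flip: T_simps(3)[OF horner_in])

lemma horner_orbit: "\<exists>cs. (T ^^ n) x = horner T x cs"
proof (induction n)
  case 0
  show ?case by (intro exI[of _ "[1]"]) (simp add: x T_zero)
next
  case (Suc n)
  then obtain cs where "(T ^^ n) x = horner T x cs" by blast
  then show ?case by (intro exI[of _ "0 # cs"]) (simp add: x horner_in T_simps)
qed

text \<open>
  Coefficients from a countable dense set suffice, so the span of an orbit is separable.
\<close>

lemma horner_approx:
  assumes D: "\<And>(c::'k) e. 0 < e \<Longrightarrow> \<exists>d\<in>D. norm (c - d) < e" and e: "0 < e"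
  shows "\<exists>ds\<in>lists D. vnorm X (horner T x cs \<ominus> horner T x ds) < e"
  using e
proof (induction cs arbitrary: e)
  case Nil
  then show ?case
    by (intro bexI[of _ "[]"]) (use vnorm_eq_0_iff[of \<zero>] in \<open>simp_all add: minus_eq_smult\<close>)
next
  case (Cons c cs)
  obtain C where C: "\<And>u. u \<in> carrier X \<Longrightarrow> vnorm X (T u) \<le> C * vnorm X u"
    using T unfolding bounded_linear_map_def by blast
  obtain d where d: "d \<in> D" "norm (c - d) < e / (2 * (vnorm X x + 1))"
    using D[of "e / (2 * (vnorm X x + 1))" c] Cons.prems vnorm_nonneg[OF x] by auto
  obtain ds where ds: "ds \<in> lists D"
      "vnorm X (horner T x cs \<ominus> horner T x ds) < e / (2 * (\<bar>C\<bar> + 1))"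
    using Cons.IH[of "e / (2 * (\<bar>C\<bar> + 1))"] Cons.prems by auto
  define u where "u = horner T x cs \<ominus> horner T x ds"
  have u: "u \<in> carrier X" by (simp add: u_def horner_in)
  have "horner T x (c # cs) \<ominus> horner T x (d # ds) = (c - d) \<odot> x \<oplus> T u"
  proof -
    have Tu: "T u = T (horner T x cs) \<ominus> T (horner T x ds)"
      by (simp add: u_def minus_eq_smult horner_in T_simps)
    have "(c - d) \<odot> x = c \<odot> x \<ominus> d \<odot> x"
      using x smult_add_left[OF x, of c "- d"] smult_mult[OF x, of "- 1" d] by (simp add: minus_eq_smult)
    with Tu show ?thesis
      using x by (simp add: a_minus_def minus_add a_ac horner_in T_simps)
  qed
  also have "vnorm X \<dots> \<le> norm (c - d) * vnorm X x + vnorm X (T u)"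
    using vnorm_triangle[of "(c - d) \<odot> x" "T u"] x u T_simps(1) by (simp add: vnorm_smult)
  also have "\<dots> < e / 2 + e / 2"
  proof (rule add_le_less_mono)
    have "norm (c - d) * vnorm X x \<le> e / (2 * (vnorm X x + 1)) * (vnorm X x + 1)"
      using d(2) vnorm_nonneg[OF x] Cons.prems by (intro mult_mono) auto
    also have "\<dots> = e / 2"
      using vnorm_nonneg[OF x] by (simp add: field_simps add_nonneg_eq_0_iff)
    finally show "norm (c - d) * vnorm X x \<le> e / 2" .
    have "vnorm X (T u) \<le> \<bar>C\<bar> * vnorm X u"
      using C[OF u] vnorm_nonneg[OF u] mult_right_mono[OF abs_ge_self[of C] vnorm_nonneg[OF u]] by linarith
    also have "\<dots> \<le> (\<bar>C\<bar> + 1) * vnorm X u"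
      using vnorm_nonneg[OF u] by (intro mult_right_mono) auto
    also have "\<dots> < (\<bar>C\<bar> + 1) * (e / (2 * (\<bar>C\<bar> + 1)))"
      using ds(2) by (intro mult_strict_left_mono) (auto simp: u_def)
    also have "\<dots> = e / 2" by (simp add: field_simps add_nonneg_eq_0_iff)
    finally show "vnorm X (T u) < e / 2" .
  qed
  finally show ?case using d(1) ds(1) by (intro bexI[of _ "d # ds"]) auto
qed

end

end

text \<open>
  Here \<open>Y\<close> is the dual space, \<open>J\<close> the canonical embedding, \<open>G\<close> the linear span of the orbit of \<open>x\<close>,
  \<open>Z\<close> its norm closure and \<open>B\<close> the annihilator of \<open>G\<close>. That the norm closure is the
  common kernel of \<open>B\<close>, and so weakly closed, is the separation theorem for the subspace \<open>G\<close>.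
\<close>

lemma reflexive_pairing:
  fixes X :: "('k::{real_normed_field,euclidean_space}, 'x) normed_module"
  assumes refl: "reflexive_space X" and T: "bounded_linear_map X X T" and x: "x \<in> carrier X"
  obtains Z B P where "weak_star_pairing X (dual_space X) (canonical_embedding X) T Z B P"
    "\<And>n. (T ^^ n) x \<in> Z"
proof -
  let ?J = "canonical_embedding X" and ?X' = "dual_space X"
  have ban: "banach_space X" and onto: "?J ` carrier X = carrier (dual_space ?X')"
    using refl by (auto simp: reflexive_space_def)
  interpret X: normed_vector_space X using ban by (rule banach_space.axioms)
  interpret Metric_space "carrier X" "vdist X" by (rule X.Metric_space_vdist)
  have J: "?J u f = f u" if "f \<in> carrier ?X'" for u f
    using that by (simp add: canonical_embedding_def)
  define G where "G = range (X.horner T x)"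
  note h_in = X.horner_in[OF T x]
  have G: "G \<subseteq> carrier X" "G \<noteq> {}" "\<And>g h. g \<in> G \<Longrightarrow> h \<in> G \<Longrightarrow> g \<oplus>\<^bsub>X\<^esub> h \<in> G"
    "\<And>c g. g \<in> G \<Longrightarrow> c \<odot>\<^bsub>X\<^esub> g \<in> G"
    using h_in X.horner_add[OF T x] X.horner_smult[OF T x] by (auto simp: G_def) (metis rangeI)
  define Z where "Z = {u \<in> carrier X. \<forall>e>0. \<exists>g\<in>G. vdist X u g < e}"
  have Z_D: "\<exists>g\<in>G. vdist X u g < e" if "u \<in> Z" "0 < e" for u e
    using that by (simp add: Z_def)
  define B where "B = {f \<in> carrier ?X'. \<forall>g\<in>G. f g = 0}"
  obtain D :: "'k set" where D: "countable D" "\<And>c e. 0 < e \<Longrightarrow> \<exists>d\<in>D. norm (c - d) < e"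
  proof -
    obtain D :: "'k set" where "countable D" "\<And>S. open S \<Longrightarrow> S \<noteq> {} \<Longrightarrow> \<exists>d\<in>D. d \<in> S"
      using countable_dense_exists[where 'a = 'k] by blast
    moreover from this(2)[of "ball c e" for c e] have "0 < e \<Longrightarrow> \<exists>d\<in>D. norm (c - d) < e" for c e
      by (auto simp: dist_norm)
    ultimately show thesis by (intro that)
  qed
  define P where "P = X.horner T x ` lists D"
  have G_Z: "G \<subseteq> Z"
    using G(1) by (force simp: Z_def)
  have orbit: "(T ^^ n) x \<in> Z" for n
    using X.horner_orbit[OF T x, of n] G_Z by (auto simp: G_def)
  have P_dense: "\<exists>c\<in>P. vdist X u c < \<eta>" if uZ: "u \<in> Z" and \<eta>: "0 < \<eta>" for u \<eta>
  proof -
    have u: "u \<in> carrier X" using uZ by (simp add: Z_def)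
    have "\<exists>g\<in>G. vdist X u g < \<eta> / 2" using uZ \<eta> by (intro Z_D) auto
    then obtain cs where cs: "vdist X u (X.horner T x cs) < \<eta> / 2"
      by (auto simp: G_def)
    obtain ds where ds: "ds \<in> lists D" "vnorm X (X.horner T x cs \<ominus>\<^bsub>X\<^esub> X.horner T x ds) < \<eta> / 2"
      using X.horner_approx[OF T x D(2), of "\<eta> / 2" cs] \<eta> by auto
    have "vdist X u (X.horner T x ds) < \<eta>"
      using triangle[OF u h_in[of cs] h_in[of ds]] cs ds(2) h_in by (simp add: vdist_def)
    with ds(1) show ?thesis by (auto simp: P_def)
  qed
  have adj: "restrict (\<lambda>v. f ((T ^^ n) v)) (carrier X) \<in> carrier ?X'" if f: "f \<in> carrier ?X'" for f n
  proof (induction n)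
    case 0
    have "restrict (\<lambda>v. f ((T ^^ 0) v)) (carrier X) = f"
      using f by (simp add: X.in_dual_iff extensional_restrict del: restrict_apply)
    with f show ?case by metis
  next
    case (Suc n)
    let ?g = "restrict (\<lambda>v. f ((T ^^ n) v)) (carrier X)"
    obtain C where C: "\<And>u. u \<in> carrier X \<Longrightarrow> vnorm X (T u) \<le> C * vnorm X u"
      using T unfolding bounded_linear_map_def by blast
    have eq: "f ((T ^^ Suc n) v) = ?g (T v)" if "v \<in> carrier X" for v
      using linear_map_simps(1)[OF T that] by (simp add: funpow_swap1)
    have g: "?g (u \<oplus>\<^bsub>X\<^esub> v) = ?g u + ?g v" "?g (c \<odot>\<^bsub>X\<^esub> u) = c * ?g u"
      if "u \<in> carrier X" "v \<in> carrier X" for u v c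
      using Suc that unfolding X.in_dual_iff by blast+
    show ?case
    proof (rule X.restrict_in_dual[where C = "\<bar>vnorm ?X' ?g\<bar> * C"])
      fix u v c assume u: "u \<in> carrier X"
      note Tu = linear_map_simps(1)[OF T u]
      show "f ((T ^^ Suc n) (u \<oplus>\<^bsub>X\<^esub> v)) = f ((T ^^ Suc n) u) + f ((T ^^ Suc n) v)" if v: "v \<in> carrier X"
        unfolding eq[OF u] eq[OF v] eq[OF X.M.add.m_closed[OF u v]] linear_map_simps(2)[OF T u v]
        by (rule g(1)[OF Tu linear_map_simps(1)[OF T v]])
      show "f ((T ^^ Suc n) (c \<odot>\<^bsub>X\<^esub> u)) = c * f ((T ^^ Suc n) u)"
        unfolding eq[OF u] eq[OF X.smult_in[OF u]] linear_map_simps(3)[OF T u]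
        by (rule g(2)[OF Tu Tu])
      have "norm (?g (T u)) \<le> vnorm ?X' ?g * vnorm X (T u)"
        by (rule X.dual_bound[OF Suc Tu])
      also have "\<dots> \<le> \<bar>vnorm ?X' ?g\<bar> * vnorm X (T u)"
        using X.vnorm_nonneg[OF Tu] by (intro mult_right_mono) auto
      also have "\<dots> \<le> \<bar>vnorm ?X' ?g\<bar> * (C * vnorm X u)"
        using C[OF u] by (rule mult_left_mono) simp
      finally show "norm (f ((T ^^ Suc n) u)) \<le> \<bar>vnorm ?X' ?g\<bar> * C * vnorm X u"
        unfolding eq[OF u] by (simp add: mult.assoc)
    qed
  qed
  have f_diff: "f (u \<ominus>\<^bsub>X\<^esub> v) = f u - f v" if "f \<in> carrier ?X'" "u \<in> carrier X" "v \<in> carrier X" for f u v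
    using that by (intro X.functional_minus) (simp_all add: X.in_dual_iff)
  have "weak_star_pairing X ?X' ?J T Z B P"
  proof
    fix u v f g c assume u: "u \<in> carrier X"
    show "?J u \<in> extensional (carrier ?X')" by (simp add: canonical_embedding_def)
    show "?J (u \<ominus>\<^bsub>X\<^esub> v) f = ?J u f - ?J v f" if "v \<in> carrier X" "f \<in> carrier ?X'"
      using that u by (simp add: J f_diff)
    have Ju: "?J u \<in> carrier (dual_space ?X')" using u onto by blast
    show "?J u (f \<oplus>\<^bsub>?X'\<^esub> g) = ?J u f + ?J u g" if "f \<in> carrier ?X'" "g \<in> carrier ?X'"
      using Ju that by (auto simp: dual_space_def[of ?X'] bounded_linear_map_def scalar_space_def)
    show "?J u (c \<odot>\<^bsub>?X'\<^esub> f) = c * ?J u f" if "f \<in> carrier ?X'"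
      using Ju that by (auto simp: dual_space_def[of ?X'] bounded_linear_map_def scalar_space_def)
    show "norm (?J u f) \<le> vnorm X u * vnorm ?X' f" if "f \<in> carrier ?X'"
      using X.dual_bound[OF that u] that by (simp add: J mult.commute)
    show "T u \<in> carrier X" using linear_map_simps(1)[OF T u] .
  next
    show "vnorm X u \<le> r" if u: "u \<in> carrier X"
      and le: "\<And>f. f \<in> carrier ?X' \<Longrightarrow> vnorm ?X' f \<le> 1 \<Longrightarrow> norm (?J u f) \<le> r" for u r
    proof -
      obtain f where "f \<in> carrier ?X'" "vnorm ?X' f \<le> 1" "norm (f u) = vnorm X u"
        using X.norming_functional[OF u] by blast
      with le[of f] show ?thesis by (simp add: J)
    qed
    show "\<exists>u\<in>Z. ?J u = \<phi>" if \<phi>: "\<phi> \<in> carrier (dual_space ?X')" "\<And>f. f \<in> B \<Longrightarrow> \<phi> f = 0" for \<phi>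
    proof -
      obtain u where u: "u \<in> carrier X" "?J u = \<phi>"
        using \<phi>(1) unfolding onto[symmetric] by (elim imageE) simp
      have "u \<in> Z"
      proof (rule ccontr)
        assume "u \<notin> Z"
        then obtain e where e: "0 < e" "\<And>g. g \<in> G \<Longrightarrow> e \<le> vdist X u g"
          using u(1) by (auto simp: Z_def not_less)
        then have "e \<le> vnorm X (u \<ominus>\<^bsub>X\<^esub> g)" if "g \<in> G" for g
          using e(2)[OF that] u(1) subsetD[OF G(1) that] by (simp add: vdist_def)
        then obtain f where f: "f \<in> carrier ?X'" "\<And>g. g \<in> G \<Longrightarrow> f g = 0" "f u \<noteq> 0"
          using X.separating_functional[OF G u(1) e(1)] by blast
        then have "\<phi> f = 0" by (intro \<phi>(2)) (simp add: B_def)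
        with f u(2) J show False by metis
      qed
      with u(2) show ?thesis by blast
    qed
    show "?J u f = 0" if u: "u \<in> Z" and f: "f \<in> B" for u f
    proof (rule ccontr)
      assume nz: "?J u f \<noteq> 0"
      have fX: "f \<in> carrier ?X'" and f0: "\<And>g. g \<in> G \<Longrightarrow> f g = 0" using f by (auto simp: B_def)
      have uX: "u \<in> carrier X" using u by (simp add: Z_def)
      have pos: "0 < norm (f u)" using nz J[OF fX] by simp
      define c where "c = \<bar>vnorm ?X' f\<bar> + 1"
      obtain g where g: "g \<in> G" "vdist X u g < norm (f u) / c"
        using Z_D[OF u, of "norm (f u) / c"] pos by (auto simp: c_def)
      have gX: "g \<in> carrier X" using g(1) G(1) by auto
      have "norm (f u) = norm (f (u \<ominus>\<^bsub>X\<^esub> g))"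
        using f_diff[OF fX uX gX] f0[OF g(1)] by simp
      also have "\<dots> \<le> vnorm ?X' f * vdist X u g"
        using X.dual_bound[OF fX, of "u \<ominus>\<^bsub>X\<^esub> g"] uX gX by (simp add: vdist_def)
      also have "\<dots> \<le> c * vdist X u g"
        by (intro mult_right_mono) (auto simp: c_def)
      also have "\<dots> < c * (norm (f u) / c)"
        using g(2) by (intro mult_strict_left_mono) (auto simp: c_def)
      also have "\<dots> = norm (f u)" by (simp add: c_def)
      finally show False by simp
    qed
    show "\<exists>S. \<forall>u\<in>carrier X. \<forall>f\<in>carrier ?X'. ?J ((T ^^ n) u) f = ?J u (S f)" for n
      by (intro exI[of _ "\<lambda>f. restrict (\<lambda>v. f ((T ^^ n) v)) (carrier X)"] ballI)
        (simp add: J adj)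
    show "0 \<le> vnorm ?X' f" if f: "f \<in> carrier ?X'" for f
    proof (cases "carrier X = {\<zero>\<^bsub>X\<^esub>}")
      case True
      have "{y \<in> carrier X. vnorm X y \<le> 1} = {\<zero>\<^bsub>X\<^esub>}"
        using True X.vnorm_eq_0_iff[of "\<zero>\<^bsub>X\<^esub>"] by auto
      then show ?thesis by (simp add: dual_space_def)
    next
      case False
      then obtain u where u: "u \<in> carrier X" "u \<noteq> \<zero>\<^bsub>X\<^esub>" by auto
      then have "0 < vnorm X u" using X.vnorm_nonneg X.vnorm_eq_0_iff by (metis less_eq_real_def)
      moreover have "0 \<le> vnorm ?X' f * vnorm X u"
        using X.dual_bound[OF f u(1)] by (meson norm_ge_zero order_trans)
      ultimately show ?thesis by (simp add: zero_le_mult_iff)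
    qed
  qed (use P_dense h_in D(1) in \<open>auto simp: P_def Z_def\<close>)
  then show thesis using orbit by (rule that)
qed

section \<open>Direct sums\<close>

lemma model_near_reiteratively_recurrent_point:
  assumes "adjoint_on_separable_dual Y S J X T \<or> (reflexive_space X \<and> bounded_linear_map X X T)"
    and x: "x \<in> RRec X T" and \<epsilon>: "0 < \<epsilon>"
  shows "\<exists>(\<nu> :: (nat \<Rightarrow> nat \<Rightarrow> bool) measure) A h.
    recurrence_model \<nu> shift A h {u \<in> carrier X. vdist X x u \<le> \<epsilon>} (vdist X) T"
proof -
  have xX: "x \<in> carrier X" using x by (simp add: RRec_def recurrent_points_def)
  from assms(1) show ?thesis
  proof
    assume adj: "adjoint_on_separable_dual Y S J X T"
    then obtain P where "weak_star_pairing X Y J T (carrier X) {} P"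
      by (rule separable_dual_pairing)
    moreover have "(T ^^ n) x \<in> carrier X" for n
      using adj linear_map_simps(4)[of X T x n] xX by (simp add: adjoint_on_separable_dual_def)
    ultimately show ?thesis
      using weak_star_pairing.model_near_point[OF _ _ x \<epsilon>] by metis
  next
    assume "reflexive_space X \<and> bounded_linear_map X X T"
    then obtain Z B P where "weak_star_pairing X (dual_space X) (canonical_embedding X) T Z B P"
      "\<And>n. (T ^^ n) x \<in> Z"
      using reflexive_pairing[OF _ _ xX] by metis
    then show ?thesis
      using weak_star_pairing.model_near_point[OF _ _ x \<epsilon>] by metis
  qed
qed

lemma product_neighbourhood:
  fixes X :: "'i \<Rightarrow> ('k::{real_normed_field,euclidean_space}, 'x) normed_module"
  assumes fin: "finite I" and X: "\<And>i. i \<in> I \<Longrightarrow> normed_vector_space (X i)"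
    and W: "openin (product_topology (\<lambda>i. norm_topology (X i)) I) W" and x: "x \<in> W"
  obtains \<eta> where "0 < \<eta>"
    "\<And>z. z \<in> (\<Pi>\<^sub>E i\<in>I. carrier (X i)) \<Longrightarrow> (\<And>i. i \<in> I \<Longrightarrow> vdist (X i) (x i) (z i) < \<eta>) \<Longrightarrow> z \<in> W"
proof -
  from bspec[OF iffD1[OF openin_product_topology_alt W] x]
  obtain U where U: "\<forall>i\<in>I. openin (norm_topology (X i)) (U i)" "x \<in> PiE I U" "PiE I U \<subseteq> W"
    by (elim exE conjE) (rule that)
  have "\<forall>i\<in>I. \<exists>r>0. \<forall>v\<in>carrier (X i). vdist (X i) (x i) v < r \<longrightarrow> v \<in> U i"
  proof
    fix i assume i: "i \<in> I"
    interpret normed_vector_space "X i" by (rule X[OF i])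
    interpret Metric_space "carrier (X i)" "vdist (X i)" by (rule Metric_space_vdist)
    have xi: "x i \<in> U i" using U(2) i by auto
    obtain r where "r > 0" "mball (x i) r \<subseteq> U i"
      using bspec[OF U(1) i] xi by (auto simp: norm_topology_def openin_mtopology)
    moreover have "x i \<in> carrier (X i)"
      using bspec[OF U(1) i] xi by (auto simp: norm_topology_def openin_mtopology)
    ultimately show "\<exists>r>0. \<forall>v\<in>carrier (X i). vdist (X i) (x i) v < r \<longrightarrow> v \<in> U i"
      by (intro exI[of _ r]) auto
  qed
  from bchoice[OF this] obtain r where
    r: "\<forall>i\<in>I. 0 < r i \<and> (\<forall>v\<in>carrier (X i). vdist (X i) (x i) v < r i \<longrightarrow> v \<in> U i)" ..
  define \<eta> where "\<eta> = Min (insert 1 (r ` I))"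
  have \<eta>: "0 < \<eta>" "\<And>i. i \<in> I \<Longrightarrow> \<eta> \<le> r i"
    using fin r by (auto simp: \<eta>_def)
  show thesis
  proof
    fix z assume z: "z \<in> (\<Pi>\<^sub>E i\<in>I. carrier (X i))" "\<And>i. i \<in> I \<Longrightarrow> vdist (X i) (x i) (z i) < \<eta>"
    have "z i \<in> U i" if "i \<in> I" for i
      using r z(2)[OF that] \<eta>(2)[OF that] z(1) that by (auto simp: PiE_iff)
    with z(1) have "z \<in> PiE I U" by (auto simp: PiE_iff)
    with U(3) show "z \<in> W" by blast
  qed (rule \<eta>(1))
qed

text \<open>
  Nothing about weak-star topologies is left here: the components are normed spaces whose
  reiteratively recurrent points have models nearby, and the norm of the sum enters only through
  its topology.
\<close>

locale recurrent_direct_sum =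
  fixes I :: "'i set"
    and X :: "'i \<Rightarrow> ('k::{real_normed_field,euclidean_space}, 'x) normed_module"
    and T :: "'i \<Rightarrow> 'x \<Rightarrow> 'x"
    and p :: "('i \<Rightarrow> 'x) \<Rightarrow> real"
  assumes finite_I: "finite I"
    and normed: "i \<in> I \<Longrightarrow> normed_vector_space (X i)"
    and T_in: "i \<in> I \<Longrightarrow> x \<in> carrier (X i) \<Longrightarrow> T i x \<in> carrier (X i)"
    and topology: "norm_topology (direct_sum I X p) = product_topology (\<lambda>i. norm_topology (X i)) I"
    and models: "i \<in> I \<Longrightarrow> x \<in> RRec (X i) (T i) \<Longrightarrow> 0 < \<epsilon> \<Longrightarrow>
      \<exists>(\<nu> :: (nat \<Rightarrow> nat \<Rightarrow> bool) measure) A h.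
        recurrence_model \<nu> shift A h {u \<in> carrier (X i). vdist (X i) x u \<le> \<epsilon>} (vdist (X i)) (T i)"
begin

abbreviation "XX \<equiv> direct_sum I X p"
abbreviation "TT \<equiv> direct_sum_operator I T"

lemma carrier_sum: "carrier XX = (\<Pi>\<^sub>E i\<in>I. carrier (X i))"
  by (simp add: direct_sum_def)

lemma funpow_sum:
  assumes "x \<in> carrier XX"
  shows "(TT ^^ n) x = (\<lambda>i\<in>I. (T i ^^ n) (x i))"
proof (induction n)
  case 0
  show ?case using assms by (auto simp: carrier_sum PiE_iff extensional_def fun_eq_iff)
qed (auto simp: direct_sum_operator_def)

lemma funpow_sum_in:
  assumes x: "x \<in> carrier XX"
  shows "(TT ^^ n) x \<in> carrier XX"
proof -
  have "(T i ^^ n) (x i) \<in> carrier (X i)" if "i \<in> I" for i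
    using x that by (induction n) (auto simp: carrier_sum PiE_iff intro: T_in)
  then show ?thesis unfolding funpow_sum[OF x] by (simp add: carrier_sum)
qed

lemma topspace_component: "i \<in> I \<Longrightarrow> topspace (norm_topology (X i)) = carrier (X i)"
  using normed_vector_space.topspace_norm_topology[OF normed] .

text \<open>
  A return of the tuple is a return of every coordinate. The density is a parameter because all
  three notions of recurrence are compared with the upper Banach density.
\<close>

lemma recurrent_points_sum_subset:
  assumes dens: "\<And>A. dens A \<le> upper_banach_density A"
  shows "recurrent_points dens XX TT \<subseteq> (\<Pi>\<^sub>E i\<in>I. RRec (X i) (T i))"
proof
  fix x assume x: "x \<in> recurrent_points dens XX TT"
  then have xX: "x \<in> carrier XX" by (simp add: recurrent_points_def)
  have "x i \<in> RRec (X i) (T i)" if i: "i \<in> I" for i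
    unfolding RRec_def recurrent_points_def
  proof (intro CollectI conjI allI impI)
    show "x i \<in> carrier (X i)" using xX i by (auto simp: carrier_sum)
    fix U assume "x i \<in> norm_topology (X i) interior_of U"
    then obtain W where W: "openin (norm_topology (X i)) W" "x i \<in> W" "W \<subseteq> U"
      by (auto simp: interior_of_def)
    define V where "V = {z \<in> carrier XX. z i \<in> W}"
    have "openin (norm_topology XX) V"
      using openin_continuous_map_preimage[OF
          continuous_map_product_projection[where X = "\<lambda>i. norm_topology (X i)", OF i] W(1)]
      by (simp add: V_def topology carrier_sum topspace_component cong: PiE_cong)
    then have "x \<in> norm_topology XX interior_of V"
      using xX W(2) by (simp add: interior_of_openin V_def)
    then have "0 < dens (return_set TT x V)"
      using x by (simp add: recurrent_points_def V_def)
    also have "\<dots> \<le> upper_banach_density (return_set TT x V)" by (rule dens)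
    also have "\<dots> \<le> upper_banach_density (return_set (T i) (x i) U)"
      using W(3) i by (intro upper_banach_density_mono) (auto simp: return_set_def V_def funpow_sum[OF xX])
    finally show "0 < upper_banach_density (return_set (T i) (x i) U)" .
  qed
  then show "x \<in> (\<Pi>\<^sub>E i\<in>I. RRec (X i) (T i))" using xX by (auto simp: carrier_sum PiE_iff)
qed

lemma product_RRec_subset_closure_FRec:
  "(\<Pi>\<^sub>E i\<in>I. RRec (X i) (T i)) \<subseteq> norm_topology XX closure_of FRec XX TT"
proof
  fix x assume x: "x \<in> (\<Pi>\<^sub>E i\<in>I. RRec (X i) (T i))"
  then have xX: "x \<in> carrier XX"
    by (auto simp: carrier_sum PiE_iff RRec_def recurrent_points_def)
  show "x \<in> norm_topology XX closure_of FRec XX TT"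
    unfolding in_closure_of
  proof (intro conjI allI impI)
    show "x \<in> topspace (norm_topology XX)"
      using xX by (simp add: topology carrier_sum topspace_component cong: PiE_cong)
    fix W assume "x \<in> W \<and> openin (norm_topology XX) W"
    then have W: "openin (product_topology (\<lambda>i. norm_topology (X i)) I) W" "x \<in> W"
      by (auto simp: topology)
    obtain \<eta> where \<eta>: "0 < \<eta>" "\<And>z. z \<in> (\<Pi>\<^sub>E i\<in>I. carrier (X i)) \<Longrightarrow>
        (\<And>i. i \<in> I \<Longrightarrow> vdist (X i) (x i) (z i) < \<eta>) \<Longrightarrow> z \<in> W"
      using product_neighbourhood[OF finite_I normed W] by blast
    define Q where "Q i = {u \<in> carrier (X i). vdist (X i) (x i) u \<le> \<eta> / 2}" for i
    have "\<forall>i\<in>I. \<exists>m. case m of (\<nu> :: (nat \<Rightarrow> nat \<Rightarrow> bool) measure, A, h) \<Rightarrow>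
        recurrence_model \<nu> shift A h (Q i) (vdist (X i)) (T i)"
    proof
      fix i assume i: "i \<in> I"
      obtain \<nu> :: "(nat \<Rightarrow> nat \<Rightarrow> bool) measure" and A h
        where "recurrence_model \<nu> shift A h (Q i) (vdist (X i)) (T i)"
        using models[OF i, of "x i" "\<eta> / 2"] x i \<eta>(1) unfolding Q_def by (auto simp: PiE_iff)
      then show "\<exists>m. case m of (\<nu> :: (nat \<Rightarrow> nat \<Rightarrow> bool) measure, A, h) \<Rightarrow>
        recurrence_model \<nu> shift A h (Q i) (vdist (X i)) (T i)"
        by (intro exI[of _ "(\<nu>, A, h)"]) simp
    qed
    from bchoice[OF this] obtain m where
      m: "\<forall>i\<in>I. case m i of (\<nu> :: (nat \<Rightarrow> nat \<Rightarrow> bool) measure, A, h) \<Rightarrow>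
        recurrence_model \<nu> shift A h (Q i) (vdist (X i)) (T i)" ..
    then have model: "recurrence_model (fst (m i)) shift (fst (snd (m i))) (snd (snd (m i))) (Q i) (vdist (X i)) (T i)"
      if "i \<in> I" for i
      using that by (simp add: case_prod_beta)
    obtain y where
      y: "y \<in> (\<Pi>\<^sub>E i\<in>I. Q i)"
      "\<And>\<eta>. 0 < \<eta> \<Longrightarrow> 0 < lower_density {n. \<forall>i\<in>I. vdist (X i) (y i) ((T i ^^ n) (y i)) < \<eta>}"
      using frequently_recurrent_tuple_exists[where I = I and \<nu> = "\<lambda>i. fst (m i)" and \<sigma> = shift
          and A = "\<lambda>i. fst (snd (m i))" and h = "\<lambda>i. snd (snd (m i))" and Q = Q
          and d = "\<lambda>i. vdist (X i)" and T = T, OF finite_I model]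
      by blast
    have yX: "y \<in> carrier XX" using y(1) by (auto simp: carrier_sum PiE_iff Q_def)
    have "vdist (X i) (x i) (y i) < \<eta>" if "i \<in> I" for i
      using y(1) that \<eta>(1) by (auto simp: PiE_iff Q_def dest!: bspec[of _ _ i])
    then have "y \<in> W" using yX by (intro \<eta>(2)) (auto simp: carrier_sum)
    moreover have "y \<in> FRec XX TT"
      unfolding FRec_def recurrent_points_def
    proof (intro CollectI conjI yX allI impI)
      fix U assume "y \<in> norm_topology XX interior_of U"
      then obtain V where V: "openin (product_topology (\<lambda>i. norm_topology (X i)) I) V" "y \<in> V" "V \<subseteq> U"
        by (auto simp: interior_of_def topology)
      obtain \<delta> where \<delta>: "0 < \<delta>" "\<And>z. z \<in> (\<Pi>\<^sub>E i\<in>I. carrier (X i)) \<Longrightarrow>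
          (\<And>i. i \<in> I \<Longrightarrow> vdist (X i) (y i) (z i) < \<delta>) \<Longrightarrow> z \<in> V"
        using product_neighbourhood[OF finite_I normed V(1,2)] by blast
      have "0 < lower_density {n. \<forall>i\<in>I. vdist (X i) (y i) ((T i ^^ n) (y i)) < \<delta>}"
        by (rule y(2)[OF \<delta>(1)])
      also have "\<dots> \<le> lower_density (return_set TT y U)"
      proof (rule lower_density_mono, rule subsetI)
        fix n assume n: "n \<in> {n. \<forall>i\<in>I. vdist (X i) (y i) ((T i ^^ n) (y i)) < \<delta>}"
        have "(TT ^^ n) y \<in> V"
          using funpow_sum_in[OF yX, of n] n by (intro \<delta>(2)) (auto simp: carrier_sum funpow_sum[OF yX])
        then show "n \<in> return_set TT y U" using V(3) by (auto simp: return_set_def)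
      qed
      finally show "0 < lower_density (return_set TT y U)" .
    qed
    ultimately show "\<exists>y. y \<in> FRec XX TT \<and> y \<in> W" by blast
  qed
qed

lemma closure_FRec_sum:
  "norm_topology XX closure_of FRec XX TT
     = (\<Pi>\<^sub>E i\<in>I. norm_topology (X i) closure_of RRec (X i) (T i))"
proof -
  have "FRec XX TT \<subseteq> (\<Pi>\<^sub>E i\<in>I. RRec (X i) (T i))"
    unfolding FRec_def
    by (intro recurrent_points_sum_subset order_trans[OF lower_density_le_upper_density
          upper_density_le_upper_banach_density])
  then have "norm_topology XX closure_of FRec XX TT
      = norm_topology XX closure_of (\<Pi>\<^sub>E i\<in>I. RRec (X i) (T i))"
    using product_RRec_subset_closure_FRec
    by (intro subset_antisym closure_of_mono closure_of_minimal) auto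
  then show ?thesis by (simp add: topology closure_of_product_topology)
qed

text \<open>
  Every set that lies between the frequently and the reiteratively recurrent points is squeezed
  between two sets with the same closure.
\<close>

lemma closure_recurrent_points_eq:
  assumes "\<And>A. lower_density A \<le> dens A" "\<And>A. dens A \<le> upper_banach_density A"
  shows "norm_topology XX closure_of recurrent_points dens XX TT = norm_topology XX closure_of FRec XX TT"
proof (rule subset_antisym)
  show "norm_topology XX closure_of recurrent_points dens XX TT \<subseteq> norm_topology XX closure_of FRec XX TT"
    using recurrent_points_sum_subset[of dens, OF assms(2)] product_RRec_subset_closure_FRec
    by (intro closure_of_minimal) auto
  have "FRec XX TT \<subseteq> recurrent_points dens XX TT"
    unfolding FRec_def recurrent_points_def using assms(1) by (blast intro: less_le_trans)
  then show "norm_topology XX closure_of FRec XX TT \<subseteq> norm_topology XX closure_of recurrent_points dens XX TT"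
    by (rule closure_of_mono)
qed

lemma frequently_recurrent_sum_iff:
  "frequently_recurrent XX TT \<longleftrightarrow> (\<forall>i\<in>I. reiteratively_recurrent (X i) (T i))"
proof -
  have "carrier (X i) \<noteq> {}" if "i \<in> I" for i
  proof -
    interpret normed_vector_space "X i" by (rule normed[OF that])
    show ?thesis using M.zero_closed by blast
  qed
  then have "(\<Pi>\<^sub>E i\<in>I. norm_topology (X i) closure_of RRec (X i) (T i)) = (\<Pi>\<^sub>E i\<in>I. carrier (X i))
      \<longleftrightarrow> (\<forall>i\<in>I. norm_topology (X i) closure_of RRec (X i) (T i) = carrier (X i))"
    unfolding PiE_eq_iff by blast
  then show ?thesis
    unfolding frequently_recurrent_def closure_FRec_sum carrier_sum reiteratively_recurrent_def .
qed

end

theorem corollary5p2: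
  fixes N :: nat
    and X :: "nat \<Rightarrow> ('k::{real_normed_field,euclidean_space}, 'x) normed_module"
    and T :: "nat \<Rightarrow> 'x \<Rightarrow> 'x"
    and Y :: "nat \<Rightarrow> ('k, 'y) normed_module"
    and S :: "nat \<Rightarrow> 'y \<Rightarrow> 'y"
    and J :: "nat \<Rightarrow> 'x \<Rightarrow> 'y \<Rightarrow> 'k"
    and p :: "(nat \<Rightarrow> 'x) \<Rightarrow> real"
  defines "XX \<equiv> direct_sum {1..N} X p"
    and "TT \<equiv> direct_sum_operator {1..N} T"
  assumes "1 \<le> N"
    and "\<forall>i\<in>{1..N}.
           adjoint_on_separable_dual (Y i) (S i) (J i) (X i) (T i) \<or>
           (reflexive_space (X i) \<and> bounded_linear_map (X i) (X i) (T i))"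
    and "direct_sum_norm {1..N} X p"
  shows "norm_topology XX closure_of FRec XX TT =
           (\<Pi>\<^sub>E i\<in>{1..N}. norm_topology (X i) closure_of RRec (X i) (T i)) \<and>
         (frequently_recurrent XX TT \<longleftrightarrow> U_frequently_recurrent XX TT) \<and>
         (U_frequently_recurrent XX TT \<longleftrightarrow> reiteratively_recurrent XX TT) \<and>
         (reiteratively_recurrent XX TT \<longleftrightarrow>
            (\<forall>i\<in>{1..N}. reiteratively_recurrent (X i) (T i)))"
proof -
  have banach: "banach_space (X i)" and bounded: "bounded_linear_map (X i) (X i) (T i)"
    if "i \<in> {1..N}" for i
    using assms(4) that by (auto simp: adjoint_on_separable_dual_def reflexive_space_def)
  interpret recurrent_direct_sum "{1..N}" X T p
  proof (rule recurrent_direct_sum.intro)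
    fix i assume i: "i \<in> {1..N}"
    show "normed_vector_space (X i)" using banach[OF i] by (rule banach_space.axioms)
    show "T i x \<in> carrier (X i)" if "x \<in> carrier (X i)" for x
      using linear_map_simps(1)[OF bounded[OF i] that] .
    show "\<exists>(\<nu> :: (nat \<Rightarrow> nat \<Rightarrow> bool) measure) A h.
        recurrence_model \<nu> shift A h {u \<in> carrier (X i). vdist (X i) x u \<le> \<epsilon>} (vdist (X i)) (T i)"
      if "x \<in> RRec (X i) (T i)" "0 < \<epsilon>" for x \<epsilon>
      by (rule model_near_reiteratively_recurrent_point[OF bspec[OF assms(4) i] that])
  qed (use assms(5) in \<open>auto simp: direct_sum_norm_def\<close>)
  have "norm_topology XX closure_of UFRec XX TT = norm_topology XX closure_of FRec XX TT"
    unfolding XX_def TT_def UFRec_def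
    by (intro closure_recurrent_points_eq lower_density_le_upper_density upper_density_le_upper_banach_density)
  moreover have "norm_topology XX closure_of RRec XX TT = norm_topology XX closure_of FRec XX TT"
    unfolding XX_def TT_def RRec_def
    by (intro closure_recurrent_points_eq order_refl order_trans[OF lower_density_le_upper_density
          upper_density_le_upper_banach_density])
  moreover note closure_FRec_sum[folded XX_def TT_def] frequently_recurrent_sum_iff[folded XX_def TT_def]
  ultimately show ?thesis
    by (simp add: frequently_recurrent_def U_frequently_recurrent_def reiteratively_recurrent_def)
qed

end
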